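(* The iteration complexity of the arc-search path-following algorithm (described in the context, with $\theta=0.19$) is $O(\sqrt{n}\log(1/\epsilon))$. Precisely: there is an absolute constant $C>0$ such that for every integer $n\ge 1$, every symmetric positive definite $H\in\mathbb{R}^{n\times n}$, every $c\in\mathbb{R}^n$, every $\epsilon\in(0,1)$ and every starting point $(x^0,p^0,\omega^0)\in\mathcal{N}_2(0.19)$ with $\mu^0\le 1/\epsilon$, the sequence generated by the algorithm satisfies: there is an index $K\le\lceil C\sqrt{n}\log(1/\epsilon)\rceil$ with $\mu^k\le\epsilon$ for all $k\ge K$.
   Context: Let $e$ denote the all-ones vector of appropriate dimension, $\circ$ the entrywise product, $\|\cdot\|$ the Euclidean norm; vector inequalities are entrywise. The problem is (QP): minimize $\frac12x^{T}Hx+c^{T}x$ subject to $-e\le x\le e$, $x\in\mathbb{R}^n$. $\mathcal{F}^o$ is the set of $(x,y,z,\lambda,\gamma)\in(\mathbb{R}^n)^5$ with $Hx+c+\lambda-\gamma=0$, $x+y=e$, $x-z=-e$, and $y,z,\lambda,\gamma>0$. Write $p=(y,z)\in\mathbb{R}^{2n}$, $\omega=(\lambda,\gamma)\in\mathbb{R}^{2n}$, and identify $(x,p,\omega)$ with $(x,y,z,\lambda,\gamma)$. The duality gap is $\mu=\frac{p^{T}\omega}{2n}$. For $0<\theta<1$, $\mathcal{N}_2(\theta)=\{(x,y,z,\lambda,\gamma)\in\mathcal{F}^o:\ \|p\circ\omega-\mu e\|\le\theta\mu\}$. The algorithm (arc-search path-following), with $\theta=0.19$: start at $(x^0,p^0,\omega^0)\in\mathcal{N}_2(\theta)$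 with $\mu^0=\frac{(p^0)^{T}\omega^0}{2n}$. For $k=0,1,2,\dots$, with $(x,y,z,\lambda,\gamma)$ the current iterate $(x^k,p^k,\omega^k)$: Step 1. Compute $(\dot x,\dot y,\dot z,\dot\lambda,\dot\gamma)$ from $H\dot x+\dot\lambda-\dot\gamma=0$, $\dot x+\dot y=0$, $\dot x-\dot z=0$, $\lambda\circ\dot y+y\circ\dot\lambda=\lambda\circ y$, $\gamma\circ\dot z+z\circ\dot\gamma=\gamma\circ z$; and $(\ddot x,\ddot y,\ddot z,\ddot\lambda,\ddot\gamma)$ from $H\ddot x+\ddot\lambda-\ddot\gamma=0$, $\ddot x+\ddot y=0$, $\ddot x-\ddot z=0$, $\lambda\circ\ddot y+y\circ\ddot\lambda=-2\dot\lambda\circ\dot y$, $\gamma\circ\ddot z+z\circ\ddot\gamma=-2\dot\gamma\circ\dot z$. Step 2. Let $\alpha\in[0,\pi/2]$ with $\sin(\alpha)=\theta/\sqrt{n}$, and set $x(\alpha)=x-\dot x\sin(\alpha)+\ddot x(1-\cos(\alpha))$, with $y(\alpha),z(\alpha),\lambda(\alpha),\gamma(\alpha)$ defined by the same formula with $x$ replaced by $y,z,\lambda,\gamma$; put $p(\alpha)=(y(\alpha),z(\alpha))$, $\omega(\alpha)=(\lambda(\alpha),\gamma(\alpha))$, $\mu(\alpha)=\frac{p(\alpha)^{T}\omega(\alpha)}{2n}$. Step 3. Compute $(\Delta x,\Delta y,\Delta z,\Delta\lambda,\Delta\gamma)$ from $H\Delta x+\Delta\lambda-\Delta\gamma=0$,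 $\Delta x+\Delta y=0$, $\Delta x-\Delta z=0$, $\lambda(\alpha)\circ\Delta y+y(\alpha)\circ\Delta\lambda=\mu(\alpha)e-\lambda(\alpha)\circ y(\alpha)$, $\gamma(\alpha)\circ\Delta z+z(\alpha)\circ\Delta\gamma=\mu(\alpha)e-\gamma(\alpha)\circ z(\alpha)$. With $\Delta p=(\Delta y,\Delta z)$, $\Delta\omega=(\Delta\lambda,\Delta\gamma)$, set $(x^{k+1},p^{k+1},\omega^{k+1})=(x(\alpha),p(\alpha),\omega(\alpha))+(\Delta x,\Delta p,\Delta\omega)$ and $\mu^{k+1}=\frac{(p^{k+1})^{T}\omega^{k+1}}{2n}$. *)

theory Defs
  imports Complex_Main "Jordan_Normal_Form.Matrix"
begin

text \<open>
  The constant in the complexity bound must not depend on the dimension, so \<open>n\<close> has to be quantified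
  inside the statement.  Vectors and matrices are therefore those of \<^theory>\<open>Jordan_Normal_Form.Matrix\<close>,
  with explicit carriers.
\<close>

abbreviation hadamard :: "real vec \<Rightarrow> real vec \<Rightarrow> real vec" (infixl \<open>\<circ>\<^sub>v\<close> 70) where
  "u \<circ>\<^sub>v v \<equiv> component_mult u v"

definition ones_vec :: "nat \<Rightarrow> real vec" where
  "ones_vec n = vec n (\<lambda>_. 1)"

definition vnorm :: "real vec \<Rightarrow> real" where
  "vnorm v = sqrt (v \<bullet> v)"

text \<open>The library's strict order on vectors is not the entrywise one.\<close>

definition pos_vec :: "real vec \<Rightarrow> bool" where
  "pos_vec v \<longleftrightarrow> (\<forall>i < dim_vec v. v $ i > 0)"

definition sym_pos_def :: "nat \<Rightarrow> real mat \<Rightarrow> bool" where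
  "sym_pos_def n H \<longleftrightarrow> H \<in> carrier_mat n n \<and> transpose_mat H = H \<and>
     (\<forall>v \<in> carrier_vec n. v \<noteq> 0\<^sub>v n \<longrightarrow> v \<bullet> (H *\<^sub>v v) > 0)"

text \<open>Points \<open>(x, y, z, \<lambda>, \<gamma>)\<close>; also used for the search directions.\<close>

record qp_point =
  xc :: "real vec"
  yc :: "real vec"
  zc :: "real vec"
  lamc :: "real vec"
  gamc :: "real vec"

definition qp_carrier :: "nat \<Rightarrow> qp_point set" where
  "qp_carrier n = {v. xc v \<in> carrier_vec n \<and> yc v \<in> carrier_vec n \<and> zc v \<in> carrier_vec n \<and>
     lamc v \<in> carrier_vec n \<and> gamc v \<in> carrier_vec n}"

definition pvec :: "qp_point \<Rightarrow> real vec" where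
  "pvec v = yc v @\<^sub>v zc v"

definition omvec :: "qp_point \<Rightarrow> real vec" where
  "omvec v = lamc v @\<^sub>v gamc v"

definition gap :: "nat \<Rightarrow> qp_point \<Rightarrow> real" where
  "gap n v = (pvec v \<bullet> omvec v) / (2 * real n)"

definition interior_feasible :: "nat \<Rightarrow> real mat \<Rightarrow> real vec \<Rightarrow> qp_point set" where
  "interior_feasible n H c = {v \<in> qp_carrier n.
     H *\<^sub>v xc v + c + lamc v - gamc v = 0\<^sub>v n \<and>
     xc v + yc v = ones_vec n \<and>
     xc v - zc v = - ones_vec n \<and>
     pos_vec (yc v) \<and> pos_vec (zc v) \<and> pos_vec (lamc v) \<and> pos_vec (gamc v)}"

definition N2 :: "nat \<Rightarrow> real mat \<Rightarrow> real vec \<Rightarrow> real \<Rightarrow> qp_point set" where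
  "N2 n H c \<theta> = {v \<in> interior_feasible n H c.
     vnorm (pvec v \<circ>\<^sub>v omvec v - gap n v \<cdot>\<^sub>v ones_vec (2 * n)) \<le> \<theta> * gap n v}"

text \<open>
  The three linear systems of the algorithm share their left-hand sides: at the point \<open>v\<close>, the
  unknown direction \<open>d\<close> is determined by the right-hand sides \<open>r\<close> and \<open>s\<close> of the two
  complementarity equations.
\<close>

definition direction_system ::
  "nat \<Rightarrow> real mat \<Rightarrow> qp_point \<Rightarrow> real vec \<Rightarrow> real vec \<Rightarrow> qp_point \<Rightarrow> bool" where
  "direction_system n H v r s d \<longleftrightarrow> d \<in> qp_carrier n \<and>
     H *\<^sub>v xc d + lamc d - gamc d = 0\<^sub>v n \<and>
     xc d + yc d = 0\<^sub>v n \<and>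
     xc d - zc d = 0\<^sub>v n \<and>
     lamc v \<circ>\<^sub>v yc d + yc v \<circ>\<^sub>v lamc d = r \<and>
     gamc v \<circ>\<^sub>v zc d + zc v \<circ>\<^sub>v gamc d = s"

definition first_direction :: "nat \<Rightarrow> real mat \<Rightarrow> qp_point \<Rightarrow> qp_point \<Rightarrow> bool" where
  "first_direction n H v d \<longleftrightarrow>
     direction_system n H v (lamc v \<circ>\<^sub>v yc v) (gamc v \<circ>\<^sub>v zc v) d"

definition second_direction :: "nat \<Rightarrow> real mat \<Rightarrow> qp_point \<Rightarrow> qp_point \<Rightarrow> qp_point \<Rightarrow> bool" where
  "second_direction n H v d dd \<longleftrightarrow>
     direction_system n H v ((-2) \<cdot>\<^sub>v (lamc d \<circ>\<^sub>v yc d)) ((-2) \<cdot>\<^sub>v (gamc d \<circ>\<^sub>v zc d)) dd"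

definition arc_vec :: "real \<Rightarrow> real vec \<Rightarrow> real vec \<Rightarrow> real vec \<Rightarrow> real vec" where
  "arc_vec \<alpha> u d dd = u - sin \<alpha> \<cdot>\<^sub>v d + (1 - cos \<alpha>) \<cdot>\<^sub>v dd"

definition arc_point :: "real \<Rightarrow> qp_point \<Rightarrow> qp_point \<Rightarrow> qp_point \<Rightarrow> qp_point" where
  "arc_point \<alpha> v d dd = \<lparr>
     xc = arc_vec \<alpha> (xc v) (xc d) (xc dd),
     yc = arc_vec \<alpha> (yc v) (yc d) (yc dd),
     zc = arc_vec \<alpha> (zc v) (zc d) (zc dd),
     lamc = arc_vec \<alpha> (lamc v) (lamc d) (lamc dd),
     gamc = arc_vec \<alpha> (gamc v) (gamc d) (gamc dd)\<rparr>"

definition corrector_direction :: "nat \<Rightarrow> real mat \<Rightarrow> qp_point \<Rightarrow> qp_point \<Rightarrow> bool" where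
  "corrector_direction n H a \<Delta> \<longleftrightarrow>
     direction_system n H a
       (gap n a \<cdot>\<^sub>v ones_vec n - lamc a \<circ>\<^sub>v yc a)
       (gap n a \<cdot>\<^sub>v ones_vec n - gamc a \<circ>\<^sub>v zc a) \<Delta>"

definition add_point :: "qp_point \<Rightarrow> qp_point \<Rightarrow> qp_point" where
  "add_point a d = \<lparr>
     xc = xc a + xc d,
     yc = yc a + yc d,
     zc = zc a + zc d,
     lamc = lamc a + lamc d,
     gamc = gamc a + gamc d\<rparr>"

definition arc_search_step :: "nat \<Rightarrow> real mat \<Rightarrow> real \<Rightarrow> qp_point \<Rightarrow> qp_point \<Rightarrow> bool" where
  "arc_search_step n H \<theta> v v' \<longleftrightarrow> (\<exists>d dd \<alpha> \<Delta>.
     first_direction n H v d \<and>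
     second_direction n H v d dd \<and>
     0 \<le> \<alpha> \<and> \<alpha> \<le> pi / 2 \<and> sin \<alpha> = \<theta> / sqrt (real n) \<and>
     corrector_direction n H (arc_point \<alpha> v d dd) \<Delta> \<and>
     v' = add_point (arc_point \<alpha> v d dd) \<Delta>)"

text \<open>
  The vector \<open>c\<close> of the objective enters the algorithm only through the feasibility of the starting
  point \<open>v0\<close>.
\<close>

definition arc_search_sequence ::
  "nat \<Rightarrow> real mat \<Rightarrow> real \<Rightarrow> qp_point \<Rightarrow> (nat \<Rightarrow> qp_point) \<Rightarrow> bool" where
  "arc_search_sequence n H \<theta> v0 v \<longleftrightarrow>
     v 0 = v0 \<and> (\<forall>k. arc_search_step n H \<theta> (v k) (v (Suc k)))"

end

theory Submission
  imports Defs "HOL-Analysis.L2_Norm" "Jordan_Normal_Form.Determinant"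
begin

text \<open>
  Write \<open>p = (y, z)\<close>, \<open>\<omega> = (\<lambda>, \<gamma>)\<close>, \<open>s = sin \<alpha>\<close> and \<open>t = 1 - cos \<alpha>\<close>.  One iteration consists of a
  predictor, which moves along the arc and decreases the gap by a factor of about \<open>1 - s\<close>, and of a
  corrector, which restores the proximity to the central path.  Since \<open>s\<close> is of order \<open>1 / sqrt n\<close>, the
  gap contracts by a factor \<open>1 - 3 / (20 sqrt n)\<close> per iteration, and it falls from \<open>1 / \<epsilon>\<close> to \<open>\<epsilon>\<close>
  within \<open>(40 / 3) sqrt n ln (1 / \<epsilon>)\<close> iterations.

  All estimates rest on one observation.  The linear constraints give \<open>u \<bullet> v = dx \<bullet> H dx \<ge> 0\<close>
  for every direction with \<open>p\<close>-part \<open>u\<close> and \<open>\<omega>\<close>-part \<open>v\<close>.  Hence, if \<open>\<omega> \<circ> u + p \<circ> v = r\<close>, then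
  dividing by \<open>sqrt (p \<circ> \<omega>)\<close> and squaring bounds the scaled squared length
  \<open>\<Sum> (\<omega> / p) u\<^sup>2 + (p / \<omega>) v\<^sup>2\<close> by \<open>\<Sum> r\<^sup>2 / (p \<omega>)\<close> (\<open>scaled_energy_le\<close>).  This length in turn controls
  the products \<open>u \<circ> v\<close>, the mixed products of two directions (\<open>sum_abs_cross_le\<close>), and the relative
  changes \<open>u / p\<close> and \<open>v / \<omega>\<close>, hence positivity (\<open>relative_direction_le\<close>).

  Along the arc, \<open>s\<^sup>2 = t (2 - t)\<close> makes the terms of second order cancel, and only terms of the
  size of \<open>t\<^sup>2\<close> and \<open>s t\<close> remain (\<open>arc_product\<close>):
  \<open>p(\<alpha>) \<circ> \<omega>(\<alpha>) = (1 - s) (p \<circ> \<omega>) + e\<close>, where the entries of \<open>e\<close> add up, in absolute value, to at most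
  \<open>0.027 \<mu>\<close>.  So the predictor ends in the neighbourhood of radius \<open>0.27\<close> with gap close to
  \<open>(1 - s) \<mu>\<close> (\<open>predictor_step\<close>).  The corrector is a Newton step towards the point of the central path
  with this gap; its error \<open>\<Delta>p \<circ> \<Delta>\<omega>\<close> is quadratic in the distance from the path, so it leads
  back into the neighbourhood of radius \<open>0.19\<close> and increases the gap by a factor of at most
  \<open>1 + 1 / (40 n)\<close> (\<open>corrector_step\<close>).

  The iterates are well defined because at a positive point each of the linear systems reduces to a
  system in \<open>dx\<close> whose matrix is \<open>H\<close> plus a positive diagonal matrix (\<open>direction_system_ex1\<close>).
\<close>

section \<open>The scaled length of a direction\<close>

text \<open>
  This is the squared norm of \<open>u\<close> and \<open>v\<close> after the primal-dual scaling, which multiplies \<open>u\<close> by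
  \<open>sqrt (w / p)\<close> and \<open>v\<close> by \<open>sqrt (p / w)\<close> and so preserves the products \<open>u v\<close>.
\<close>

definition scaled_energy ::
  "'i set \<Rightarrow> ('i \<Rightarrow> real) \<Rightarrow> ('i \<Rightarrow> real) \<Rightarrow> ('i \<Rightarrow> real) \<Rightarrow> ('i \<Rightarrow> real) \<Rightarrow> real" where
  "scaled_energy I p w u v = (\<Sum>i\<in>I. w i / p i * (u i)\<^sup>2 + p i / w i * (v i)\<^sup>2)"

lemma abs_le_mean_if_square_eq:
  fixes a b c :: real
  assumes "0 \<le> a" "0 \<le> b" "c\<^sup>2 = a * b"
  shows "\<bar>c\<bar> \<le> (a + b) / 2"
proof (rule power2_le_imp_le)
  have "0 \<le> (a - b)\<^sup>2" by simp
  then show "\<bar>c\<bar>\<^sup>2 \<le> ((a + b) / 2)\<^sup>2"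
    using assms(3) by (simp add: power2_eq_square field_simps)
qed (use assms in simp)

text \<open>
  Squaring \<open>(w u + p v) / sqrt (p w)\<close> gives the terms of the energy and the cross term \<open>2 u v\<close>, whose
  sum has the right sign.
\<close>

lemma scaled_energy_le:
  assumes pos: "\<And>i. i \<in> I \<Longrightarrow> 0 < p i" "\<And>i. i \<in> I \<Longrightarrow> 0 < w i"
    and eq: "\<And>i. i \<in> I \<Longrightarrow> w i * u i + p i * v i = r i"
    and nonneg: "0 \<le> (\<Sum>i\<in>I. u i * v i)"
  shows "scaled_energy I p w u v \<le> (\<Sum>i\<in>I. (r i)\<^sup>2 / (p i * w i))"
proof -
  have "w i / p i * (u i)\<^sup>2 + p i / w i * (v i)\<^sup>2 + 2 * (u i * v i) = (r i)\<^sup>2 / (p i * w i)"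
    if "i \<in> I" for i
    unfolding eq[OF that, symmetric] using pos[OF that]
    by (simp add: power2_eq_square field_simps)
  then have "(\<Sum>i\<in>I. (r i)\<^sup>2 / (p i * w i))
      = (\<Sum>i\<in>I. w i / p i * (u i)\<^sup>2 + p i / w i * (v i)\<^sup>2 + 2 * (u i * v i))"
    by simp
  also have "\<dots> = scaled_energy I p w u v + 2 * (\<Sum>i\<in>I. u i * v i)"
    by (simp add: scaled_energy_def sum.distrib sum_distrib_left)
  finally show ?thesis using nonneg by simp
qed

text \<open>
  In \<open>\<bar>u v'\<bar>\<close> the scaling weights \<open>sqrt (w / p)\<close> and \<open>sqrt (p / w)\<close> cancel, so that the inequality of the
  arithmetic and geometric means applies.  The parameter \<open>\<kappa>\<close> balances directions of
  different order of magnitude; the best choice is \<open>sqrt (E' / E)\<close> for energies \<open>E\<close> and \<open>E'\<close>.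
\<close>

lemma sum_abs_cross_le:
  assumes pos: "\<And>i. i \<in> I \<Longrightarrow> 0 < p i" "\<And>i. i \<in> I \<Longrightarrow> 0 < w i"
    and "0 < \<kappa>"
  shows "(\<Sum>i\<in>I. \<bar>u i * v' i + u' i * v i\<bar>)
    \<le> (\<kappa> * scaled_energy I p w u v + scaled_energy I p w u' v' / \<kappa>) / 2"
proof -
  have "\<bar>u i * v' i + u' i * v i\<bar> \<le> (\<kappa> * (w i / p i * (u i)\<^sup>2 + p i / w i * (v i)\<^sup>2)
      + (w i / p i * (u' i)\<^sup>2 + p i / w i * (v' i)\<^sup>2) / \<kappa>) / 2" if i: "i \<in> I" for i
  proof -
    have "\<bar>u i * v' i\<bar> \<le> (\<kappa> * (w i / p i * (u i)\<^sup>2) + p i / w i * (v' i)\<^sup>2 / \<kappa>) / 2"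
      using pos[OF i] \<open>0 < \<kappa>\<close>
      by (intro abs_le_mean_if_square_eq) (simp, simp, simp add: power_mult_distrib)
    moreover have "\<bar>u' i * v i\<bar> \<le> (\<kappa> * (p i / w i * (v i)\<^sup>2) + w i / p i * (u' i)\<^sup>2 / \<kappa>) / 2"
      using pos[OF i] \<open>0 < \<kappa>\<close>
      by (intro abs_le_mean_if_square_eq) (simp, simp, simp add: power_mult_distrib)
    moreover have "\<bar>u i * v' i + u' i * v i\<bar> \<le> \<bar>u i * v' i\<bar> + \<bar>u' i * v i\<bar>" by simp
    ultimately show ?thesis by (simp add: distrib_left add_divide_distrib)
  qed
  then have "(\<Sum>i\<in>I. \<bar>u i * v' i + u' i * v i\<bar>) \<le> (\<Sum>i\<in>I.
      (\<kappa> * (w i / p i * (u i)\<^sup>2 + p i / w i * (v i)\<^sup>2)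
      + (w i / p i * (u' i)\<^sup>2 + p i / w i * (v' i)\<^sup>2) / \<kappa>) / 2)"
    by (rule sum_mono)
  also have "\<dots> = (\<kappa> * scaled_energy I p w u v + scaled_energy I p w u' v' / \<kappa>) / 2"
    by (simp only: scaled_energy_def sum.distrib sum_distrib_left[symmetric]
        sum_divide_distrib[symmetric])
  finally show ?thesis .
qed

lemma sum_abs_prod_le:
  assumes pos: "\<And>i. i \<in> I \<Longrightarrow> 0 < p i" "\<And>i. i \<in> I \<Longrightarrow> 0 < w i"
  shows "(\<Sum>i\<in>I. \<bar>u i * v i\<bar>) \<le> scaled_energy I p w u v / 2"
proof -
  have "(\<Sum>i\<in>I. \<bar>u i * v i + u i * v i\<bar>)
    \<le> (1 * scaled_energy I p w u v + scaled_energy I p w u v / 1) / 2"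
    by (rule sum_abs_cross_le) (use pos in auto)
  moreover have "(\<Sum>i\<in>I. \<bar>u i * v i + u i * v i\<bar>) = 2 * (\<Sum>i\<in>I. \<bar>u i * v i\<bar>)"
    unfolding sum_distrib_left by (rule sum.cong) auto
  ultimately show ?thesis by simp
qed

text \<open>
  The term \<open>(w / p) u\<^sup>2 = p w (u / p)\<^sup>2\<close> of the energy bounds the relative change \<open>u / p\<close>.  A relative change
  below 1 keeps a positive coordinate positive, so this replaces a continuity argument along the arc.
\<close>

lemma relative_direction_le:
  assumes fin: "finite I" and pos: "\<And>i. i \<in> I \<Longrightarrow> 0 < p i" "\<And>i. i \<in> I \<Longrightarrow> 0 < w i"
    and i: "i \<in> I" and E: "scaled_energy I p w u v \<le> k\<^sup>2 * L"
    and L: "L \<le> p i * w i" and k: "0 \<le> k"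
  shows "\<bar>u i\<bar> \<le> k * p i" "\<bar>v i\<bar> \<le> k * w i"
proof -
  have "w i / p i * (u i)\<^sup>2 + p i / w i * (v i)\<^sup>2 \<le> scaled_energy I p w u v"
    unfolding scaled_energy_def by (rule member_le_sum[OF i]) (simp_all add: pos less_imp_le fin)
  also have "\<dots> \<le> k\<^sup>2 * (p i * w i)"
    using E L by (meson mult_left_mono order_trans zero_le_power2)
  finally have *: "w i / p i * (u i)\<^sup>2 + p i / w i * (v i)\<^sup>2 \<le> k\<^sup>2 * (p i * w i)" .
  have "0 \<le> w i / p i * (u i)\<^sup>2" "0 \<le> p i / w i * (v i)\<^sup>2"
    using pos[OF i] by simp_all
  with * have "w i / p i * (u i)\<^sup>2 \<le> k\<^sup>2 * (p i * w i)" "p i / w i * (v i)\<^sup>2 \<le> k\<^sup>2 * (p i * w i)"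
    by linarith+
  then have "(u i)\<^sup>2 \<le> (k * p i)\<^sup>2" "(v i)\<^sup>2 \<le> (k * w i)\<^sup>2"
    using pos[OF i] by (simp_all add: power2_eq_square field_simps)
  then show "\<bar>u i\<bar> \<le> k * p i" "\<bar>v i\<bar> \<le> k * w i"
    using pos[OF i] k by (simp_all add: abs_le_square_iff[symmetric] abs_mult)
qed

section \<open>Norms on finite index sets\<close>

lemma sum_power2_le_power2_sum_abs:
  fixes f :: "'i \<Rightarrow> real"
  assumes "finite I"
  shows "(\<Sum>i\<in>I. (f i)\<^sup>2) \<le> (\<Sum>i\<in>I. \<bar>f i\<bar>)\<^sup>2"
proof -
  have "(\<Sum>i\<in>I. (f i)\<^sup>2) = (L2_set f I)\<^sup>2"
    by (simp add: L2_set_def sum_nonneg)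
  also have "\<dots> \<le> (\<Sum>i\<in>I. \<bar>f i\<bar>)\<^sup>2"
    by (intro power_mono L2_set_le_sum_abs) simp
  finally show ?thesis .
qed

lemma abs_le_L2_set: "\<bar>f i\<bar> \<le> L2_set f I" if "finite I" "i \<in> I"
proof -
  have "\<bar>f i\<bar> \<le> L2_set (\<lambda>i. \<bar>f i\<bar>) I" by (rule member_le_L2_set) (use that in auto)
  then show ?thesis by (simp add: L2_set_def)
qed

lemma L2_set_centred_le:
  fixes f :: "'i \<Rightarrow> real"
  assumes "finite I" "I \<noteq> {}"
  shows "L2_set (\<lambda>i. f i - (\<Sum>j\<in>I. f j) / card I) I \<le> 2 * (\<Sum>i\<in>I. \<bar>f i\<bar>)"
proof -
  have "L2_set (\<lambda>i. f i - (\<Sum>j\<in>I. f j) / card I) I \<le> (\<Sum>i\<in>I. \<bar>f i - (\<Sum>j\<in>I. f j) / card I\<bar>)"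
    by (rule L2_set_le_sum_abs)
  also have "\<dots> \<le> (\<Sum>i\<in>I. \<bar>f i\<bar> + (\<Sum>j\<in>I. \<bar>f j\<bar>) / card I)"
  proof (rule sum_mono)
    fix i
    have "\<bar>(\<Sum>j\<in>I. f j) / card I\<bar> \<le> (\<Sum>j\<in>I. \<bar>f j\<bar>) / card I"
      by (simp add: divide_right_mono sum_abs)
    then show "\<bar>f i - (\<Sum>j\<in>I. f j) / card I\<bar> \<le> \<bar>f i\<bar> + (\<Sum>j\<in>I. \<bar>f j\<bar>) / card I" by linarith
  qed
  also have "\<dots> = 2 * (\<Sum>i\<in>I. \<bar>f i\<bar>)"
    using assms by (simp add: sum.distrib)
  finally show ?thesis .
qed

section \<open>Predictor and corrector in coordinates\<close>

text \<open>
  The terms in \<open>p1 w1\<close> have the coefficient \<open>s\<^sup>2 - 2 t = - t\<^sup>2\<close>: the second direction is chosen so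
  that the arc follows the curve \<open>p(\<alpha>) w(\<alpha>) = (1 - s) p w\<close> up to errors of third order.
\<close>

lemma arc_product:
  fixes p w :: real
  assumes "w * p1 + p * w1 = w * p" "w * p2 + p * w2 = - 2 * (w1 * p1)"
    and st: "s\<^sup>2 = t * (2 - t)"
  shows "(p - s * p1 + t * p2) * (w - s * w1 + t * w2)
    = (1 - s) * (p * w) + (t\<^sup>2 * (p2 * w2 - p1 * w1) - s * t * (p1 * w2 + p2 * w1))"
proof -
  have "(p - s * p1 + t * p2) * (w - s * w1 + t * w2)
    = p * w - s * (w * p1 + p * w1) + t * (w * p2 + p * w2) + s\<^sup>2 * (p1 * w1)
      - s * t * (p1 * w2 + p2 * w1) + t\<^sup>2 * (p2 * w2)"
    by (simp add: algebra_simps power2_eq_square)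
  also have "\<dots> = (1 - s) * (p * w) + (t\<^sup>2 * (p2 * w2 - p1 * w1) - s * t * (p1 * w2 + p2 * w1))"
    unfolding assms by (simp add: algebra_simps power2_eq_square)
  finally show ?thesis .
qed

text \<open>
  With \<open>q = sqrt n\<close>, the first direction has energy \<open>E1 \<le> 2 n \<mu>\<close>, since its right-hand side is
  \<open>p w\<close> itself, and the second one has \<open>E2 = O(n\<^sup>2 \<mu>)\<close>, since its right-hand side is a product with sum
  \<open>O(n \<mu>)\<close>.  As \<open>s = O(1 / q)\<close> and \<open>t = O(1 / n)\<close>, the errors \<open>t\<^sup>2 E1\<close>, \<open>t\<^sup>2 E2\<close> and \<open>s t sqrt (E1 E2)\<close>
  are all \<open>O(\<mu>)\<close> with small constants.
\<close>

lemma predictor_estimates: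
  fixes p w p1 w1 p2 w2 :: "nat \<Rightarrow> real" and n :: nat and \<alpha> :: real
  defines "I \<equiv> {..<2 * n}"
    and "P \<equiv> \<lambda>i. p i - sin \<alpha> * p1 i + (1 - cos \<alpha>) * p2 i"
    and "W \<equiv> \<lambda>i. w i - sin \<alpha> * w1 i + (1 - cos \<alpha>) * w2 i"
    and "\<mu> \<equiv> (\<Sum>i<2*n. p i * w i) / (2 * real n)"
  defines "\<mu>' \<equiv> (\<Sum>i\<in>I. P i * W i) / (2 * real n)"
  assumes n: "1 \<le> n"
    and pos: "\<And>i. i \<in> I \<Longrightarrow> 0 < p i" "\<And>i. i \<in> I \<Longrightarrow> 0 < w i"
    and near: "L2_set (\<lambda>i. p i * w i - \<mu>) I \<le> 19 / 100 * \<mu>"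
    and first: "\<And>i. i \<in> I \<Longrightarrow> w i * p1 i + p i * w1 i = w i * p i"
    and second: "\<And>i. i \<in> I \<Longrightarrow> w i * p2 i + p i * w2 i = - 2 * (w1 i * p1 i)"
    and nonneg: "0 \<le> (\<Sum>i\<in>I. p1 i * w1 i)" "0 \<le> (\<Sum>i\<in>I. p2 i * w2 i)"
    and \<alpha>: "0 \<le> \<alpha>" "\<alpha> \<le> pi / 2" "sin \<alpha> = 19 / 100 / sqrt n"
  shows "0 < \<mu>" "\<And>i. i \<in> I \<Longrightarrow> 0 < P i" "\<And>i. i \<in> I \<Longrightarrow> 0 < W i"
    and "\<bar>\<mu>' - (1 - sin \<alpha>) * \<mu>\<bar> \<le> 27 / 2000 * \<mu> / n"
    and "L2_set (\<lambda>i. P i * W i - \<mu>') I \<le> 27 / 100 * \<mu>'"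
proof -
  define q s t where "q = sqrt n" and "s = sin \<alpha>" and "t = 1 - cos \<alpha>"
  have fin: "finite I" and ne: "I \<noteq> {}" and card: "real (card I) = 2 * real n"
    using n by (auto simp: I_def lessThan_empty_iff)
  have q: "1 \<le> q" "q\<^sup>2 = real n" using n by (auto simp: q_def)
  have s_eq: "s = 19 / 100 / q" using \<alpha> by (simp add: s_def q_def)
  have s: "0 \<le> s" "s \<le> 19 / 100" using q by (simp_all add: s_eq field_simps)
  have "0 \<le> cos \<alpha>" using \<alpha> by (intro cos_ge_zero) auto
  then have t: "0 \<le> t" "t \<le> 1" by (auto simp: t_def)
  have st: "s\<^sup>2 = t * (2 - t)"
    using sin_cos_squared_add[of \<alpha>] by (simp add: s_def t_def power2_eq_square algebra_simps)
  \<comment> \<open>From \<open>0 \<le> t \<le> 1\<close>: \<open>t \<le> t (2 - t) = s\<^sup>2\<close>.\<close>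
  have t_le: "t \<le> (19 / 100)\<^sup>2 / n"
  proof -
    have "t * 1 \<le> t * (2 - t)" using t by (intro mult_left_mono) auto
    also have "\<dots> = (19 / 100)\<^sup>2 / n" using q by (simp flip: st add: power_divide s_eq)
    finally show ?thesis by simp
  qed
  have sum_pw: "(\<Sum>i\<in>I. p i * w i) = 2 * real n * \<mu>"
    using n by (simp add: \<mu>_def I_def)
  have "0 < (\<Sum>i\<in>I. p i * w i)" using pos fin ne by (intro sum_pos) auto
  then show mu: "0 < \<mu>" using n by (simp add: sum_pw zero_less_mult_iff)
  have lower: "81 / 100 * \<mu> \<le> p i * w i" if "i \<in> I" for i
    using abs_le_L2_set[OF fin that, of "\<lambda>i. p i * w i - \<mu>"] near by simp

  define E1 E2 where "E1 = scaled_energy I p w p1 w1" and "E2 = scaled_energy I p w p2 w2"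
  have E1: "E1 \<le> 2 * n * \<mu>"
  proof -
    have "E1 \<le> (\<Sum>i\<in>I. (w i * p i)\<^sup>2 / (p i * w i))"
      unfolding E1_def by (rule scaled_energy_le[OF pos first nonneg(1)])
    also have "\<dots> = (\<Sum>i\<in>I. p i * w i)"
      by (rule sum.cong) (auto simp: power2_eq_square)
    finally show ?thesis by (simp add: sum_pw)
  qed
  have "(\<Sum>i\<in>I. \<bar>p1 i * w1 i\<bar>) \<le> scaled_energy I p w p1 w1 / 2"
    by (intro sum_abs_prod_le pos)
  then have prod1: "(\<Sum>i\<in>I. \<bar>p1 i * w1 i\<bar>) \<le> n * \<mu>"
    using E1 by (simp add: E1_def)
  have E2: "E2 \<le> 400 / 81 * n\<^sup>2 * \<mu>"
  proof -
    have "E2 \<le> (\<Sum>i\<in>I. (- 2 * (w1 i * p1 i))\<^sup>2 / (p i * w i))"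
      unfolding E2_def by (rule scaled_energy_le[OF pos second nonneg(2)])
    also have "\<dots> \<le> (\<Sum>i\<in>I. 400 / 81 / \<mu> * (p1 i * w1 i)\<^sup>2)"
    proof (rule sum_mono)
      fix i assume i: "i \<in> I"
      have "(- 2 * (w1 i * p1 i))\<^sup>2 / (p i * w i) \<le> (- 2 * (w1 i * p1 i))\<^sup>2 / (81 / 100 * \<mu>)"
        using lower[OF i] mu by (intro divide_left_mono) (auto simp: pos i)
      then show "(- 2 * (w1 i * p1 i))\<^sup>2 / (p i * w i) \<le> 400 / 81 / \<mu> * (p1 i * w1 i)\<^sup>2"
        by (simp add: power_mult_distrib mult.commute)
    qed
    also have "\<dots> \<le> 400 / 81 / \<mu> * (\<Sum>i\<in>I. \<bar>p1 i * w1 i\<bar>)\<^sup>2"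
      unfolding sum_distrib_left[symmetric]
      using mu fin by (intro mult_left_mono sum_power2_le_power2_sum_abs) auto
    also have "\<dots> \<le> 400 / 81 / \<mu> * (n * \<mu>)\<^sup>2"
      using mu prod1 by (intro mult_left_mono power_mono) (auto intro: sum_nonneg)
    also have "\<dots> = 400 / 81 * n\<^sup>2 * \<mu>" using mu by (simp add: power2_eq_square)
    finally show ?thesis .
  qed

  show P_pos: "0 < P i" and W_pos: "0 < W i" if i: "i \<in> I" for i
  proof -
    \<comment> \<open>The rates \<open>8 / 5\<close> and \<open>5 / 2\<close> round up \<open>sqrt (2 / 0.81)\<close> and \<open>2 / 0.81\<close>.\<close>
    have "2 * n * \<mu> \<le> (8 / 5 * q)\<^sup>2 * (81 / 100 * \<mu>)"
      using mu by (simp only: power_mult_distrib q) (simp add: power2_eq_square)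
    with E1 have "scaled_energy I p w p1 w1 \<le> (8 / 5 * q)\<^sup>2 * (81 / 100 * \<mu>)"
      unfolding E1_def by linarith
    from relative_direction_le[OF fin pos i this lower[OF i]]
    have d1: "\<bar>p1 i\<bar> \<le> 8 / 5 * q * p i" "\<bar>w1 i\<bar> \<le> 8 / 5 * q * w i" using q by auto
    have "400 / 81 * n\<^sup>2 * \<mu> \<le> (5 / 2 * n)\<^sup>2 * (81 / 100 * \<mu>)"
      using mu by (simp add: power_mult_distrib power2_eq_square)
    with E2 have "scaled_energy I p w p2 w2 \<le> (5 / 2 * n)\<^sup>2 * (81 / 100 * \<mu>)"
      unfolding E2_def by linarith
    from relative_direction_le[OF fin pos i this lower[OF i]]
    have d2: "\<bar>p2 i\<bar> \<le> 5 / 2 * n * p i" "\<bar>w2 i\<bar> \<le> 5 / 2 * n * w i" by auto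
    have sq: "s * (8 / 5 * q) = 304 / 1000" using q by (simp add: s_eq)
    have tn: "t * (5 / 2 * n) \<le> 1 / 10"
      using t_le n by (simp add: field_simps power2_eq_square)
    have *: "0 < x - s * x1 + t * x2"
      if "0 < x" "\<bar>x1\<bar> \<le> 8 / 5 * q * x" "\<bar>x2\<bar> \<le> 5 / 2 * n * x" for x x1 x2
    proof -
      have "s * x1 \<le> s * (8 / 5 * q * x)" using that s by (intro mult_left_mono) auto
      also have "\<dots> = 304 / 1000 * x" by (simp flip: sq)
      finally have 1: "s * x1 \<le> 304 / 1000 * x" .
      have "t * - x2 \<le> t * (5 / 2 * n * x)" using that t by (intro mult_left_mono) auto
      also have "\<dots> = t * (5 / 2 * n) * x" by simp
      also have "\<dots> \<le> 1 / 10 * x" using tn that by (intro mult_right_mono) auto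
      finally show ?thesis using 1 that by simp
    qed
    show "0 < P i" "0 < W i"
      unfolding P_def W_def s_def[symmetric] t_def[symmetric] by (auto intro!: * pos d1 d2 i)
  qed

  define e where "e i = t\<^sup>2 * (p2 i * w2 i - p1 i * w1 i)
    - s * t * (p1 i * w2 i + p2 i * w1 i)" for i
  have PW: "P i * W i = (1 - s) * (p i * w i) + e i" if "i \<in> I" for i
    unfolding P_def W_def s_def[symmetric] t_def[symmetric] e_def
    by (rule arc_product[OF first[OF that] second[OF that] st])
  have sum_e: "(\<Sum>i\<in>I. \<bar>e i\<bar>) \<le> 27 / 1000 * \<mu>"
  proof -
    have "(\<Sum>i\<in>I. \<bar>p2 i * w2 i\<bar>) \<le> scaled_energy I p w p2 w2 / 2"
      by (intro sum_abs_prod_le pos)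
    then have prod2: "(\<Sum>i\<in>I. \<bar>p2 i * w2 i\<bar>) \<le> 200 / 81 * n\<^sup>2 * \<mu>"
      using E2 by (simp add: E2_def)
    \<comment> \<open>The balancing factor \<open>sqrt (E2 / E1)\<close> is about \<open>1.57 q\<close> for the upper bounds on \<open>E1\<close> and \<open>E2\<close>.\<close>
    have "(\<Sum>i\<in>I. \<bar>p1 i * w2 i + p2 i * w1 i\<bar>) \<le> (3 / 2 * q * E1 + E2 / (3 / 2 * q)) / 2"
      unfolding E1_def E2_def using q by (intro sum_abs_cross_le pos) auto
    also have "\<dots> \<le> (3 / 2 * q * (2 * n * \<mu>) + 400 / 81 * n\<^sup>2 * \<mu> / (3 / 2 * q)) / 2"
      using E1 E2 q by (intro divide_right_mono add_mono mult_left_mono) auto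
    also have "\<dots> = (3 / 2 + 400 / 243) * (q * n * \<mu>)"
      using q by (simp add: q(2)[symmetric] power2_eq_square field_simps)
    also have "\<dots> \<le> 63 / 20 * (q * n * \<mu>)"
      using q mu by (intro mult_right_mono) auto
    finally have cross: "(\<Sum>i\<in>I. \<bar>p1 i * w2 i + p2 i * w1 i\<bar>) \<le> 63 / 20 * (q * n * \<mu>)" .
    \<comment> \<open>The constants below bound \<open>0.19 ^ 4\<close> and \<open>0.19 ^ 3\<close>.\<close>
    have "t\<^sup>2 \<le> ((19 / 100)\<^sup>2 / n)\<^sup>2" using t t_le by (intro power_mono) auto
    then have t2: "t\<^sup>2 \<le> 14 / 10000 / n\<^sup>2"
      using n by (simp add: power_divide field_simps)
    have "s * t \<le> 19 / 100 / q * ((19 / 100)\<^sup>2 / n)"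
      unfolding s_eq using t_le q by (intro mult_left_mono) auto
    then have st3: "s * t \<le> 6859 / 1000000 / (q * n)"
      by (simp add: power2_eq_square field_simps)
    have "(\<Sum>i\<in>I. \<bar>e i\<bar>) \<le> (\<Sum>i\<in>I. t\<^sup>2 * \<bar>p2 i * w2 i\<bar> + t\<^sup>2 * \<bar>p1 i * w1 i\<bar>
        + s * t * \<bar>p1 i * w2 i + p2 i * w1 i\<bar>)"
    proof (rule sum_mono)
      fix i
      have *: "\<bar>a * (x - y) - b * z\<bar> \<le> a * \<bar>x\<bar> + a * \<bar>y\<bar> + b * \<bar>z\<bar>"
        if "0 \<le> a" "0 \<le> b" for a b x y z :: real
      proof -
        have "\<bar>a * (x - y) - b * z\<bar> \<le> \<bar>a * x\<bar> + \<bar>a * y\<bar> + \<bar>b * z\<bar>"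
          unfolding right_diff_distrib by linarith
        then show ?thesis using that by (simp add: abs_mult)
      qed
      show "\<bar>e i\<bar> \<le> t\<^sup>2 * \<bar>p2 i * w2 i\<bar> + t\<^sup>2 * \<bar>p1 i * w1 i\<bar>
        + s * t * \<bar>p1 i * w2 i + p2 i * w1 i\<bar>"
        unfolding e_def using s t by (intro *) auto
    qed
    also have "\<dots> = t\<^sup>2 * ((\<Sum>i\<in>I. \<bar>p2 i * w2 i\<bar>) + (\<Sum>i\<in>I. \<bar>p1 i * w1 i\<bar>))
        + s * t * (\<Sum>i\<in>I. \<bar>p1 i * w2 i + p2 i * w1 i\<bar>)"
      by (simp add: sum.distrib sum_distrib_left distrib_left)
    also have "\<dots> \<le> 14 / 10000 / n\<^sup>2 * (200 / 81 * n\<^sup>2 * \<mu> + n * \<mu>)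
        + 6859 / 1000000 / (q * n) * (63 / 20 * (q * n * \<mu>))"
      using prod1 prod2 cross t2 st3 s t q
      by (intro add_mono mult_mono add_nonneg_nonneg sum_nonneg) auto
    also have "\<dots> = 14 / 10000 * (200 / 81 * \<mu> + \<mu> / n) + 6859 / 1000000 * (63 / 20 * \<mu>)"
      using n q by (simp add: field_simps power2_eq_square)
    also have "\<dots> \<le> 14 / 10000 * (200 / 81 * \<mu> + \<mu>) + 6859 / 1000000 * (63 / 20 * \<mu>)"
      using n mu by (intro add_mono mult_left_mono) (auto simp: field_simps)
    also have "\<dots> \<le> 27 / 1000 * \<mu>" using mu by simp
    finally show ?thesis .
  qed

  have "(\<Sum>i\<in>I. P i * W i) = (1 - s) * (2 * n * \<mu>) + (\<Sum>i\<in>I. e i)"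
    by (simp add: PW sum.distrib flip: sum_pw sum_distrib_left)
  then have mu'_eq: "\<mu>' = (1 - s) * \<mu> + (\<Sum>i\<in>I. e i) / card I"
    using n unfolding \<mu>'_def card by (simp add: field_simps)
  have "\<bar>(\<Sum>i\<in>I. e i) / card I\<bar> \<le> (\<Sum>i\<in>I. \<bar>e i\<bar>) / card I"
    by (simp add: divide_right_mono sum_abs)
  also have "\<dots> \<le> 27 / 1000 * \<mu> / card I" using sum_e by (intro divide_right_mono) auto
  also have "\<dots> = 27 / 2000 * \<mu> / n" unfolding card by simp
  finally have mu'_near: "\<bar>\<mu>' - (1 - s) * \<mu>\<bar> \<le> 27 / 2000 * \<mu> / n"
    by (simp add: mu'_eq)
  then show "\<bar>\<mu>' - (1 - sin \<alpha>) * \<mu>\<bar> \<le> 27 / 2000 * \<mu> / n" by (simp add: s_def)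

  \<comment> \<open>The deviation from the mean is the old one, scaled by \<open>1 - s\<close>, plus that of \<open>e\<close>.\<close>
  have "L2_set (\<lambda>i. P i * W i - \<mu>') I
      = L2_set (\<lambda>i. (1 - s) * (p i * w i - \<mu>) + (e i - (\<Sum>j\<in>I. e j) / card I)) I"
    by (rule L2_set_cong) (auto simp: PW mu'_eq algebra_simps)
  also have "\<dots> \<le> L2_set (\<lambda>i. (1 - s) * (p i * w i - \<mu>)) I
      + L2_set (\<lambda>i. e i - (\<Sum>j\<in>I. e j) / card I) I"
    by (rule L2_set_triangle_ineq)
  also have "\<dots> \<le> (1 - s) * (19 / 100 * \<mu>) + 54 / 1000 * \<mu>"
  proof (rule add_mono)
    have "L2_set (\<lambda>i. (1 - s) * (p i * w i - \<mu>)) I = (1 - s) * L2_set (\<lambda>i. p i * w i - \<mu>) I"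
      using s by (intro L2_set_right_distrib[symmetric]) auto
    also have "\<dots> \<le> (1 - s) * (19 / 100 * \<mu>)"
      using near s by (intro mult_left_mono) auto
    finally show "L2_set (\<lambda>i. (1 - s) * (p i * w i - \<mu>)) I \<le> (1 - s) * (19 / 100 * \<mu>)" .
    show "L2_set (\<lambda>i. e i - (\<Sum>j\<in>I. e j) / card I) I \<le> 54 / 1000 * \<mu>"
      using L2_set_centred_le[OF fin ne, of e] sum_e by linarith
  qed
  also have "\<dots> \<le> 27 / 100 * \<mu>'"
  proof -
    \<comment> \<open>The step loses proximity; radius \<open>0.27\<close> suffices because \<open>1 - s \<ge> 0.81\<close>.\<close>
    have "27 / 2000 * \<mu> / n \<le> 27 / 2000 * \<mu>" using n mu by (simp add: field_simps)
    then have "(1 - s) * \<mu> - 27 / 2000 * \<mu> \<le> \<mu>'" using mu'_near by linarith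
    moreover have "81 / 100 * \<mu> \<le> (1 - s) * \<mu>" using s mu by (intro mult_right_mono) auto
    moreover have "19 / 100 * M + 54 / 1000 * \<mu> \<le> 27 / 100 * m"
      if "M - 27 / 2000 * \<mu> \<le> m" "81 / 100 * \<mu> \<le> M" for M m :: real
      using that mu by linarith
    moreover have "(1 - s) * (19 / 100 * \<mu>) = 19 / 100 * ((1 - s) * \<mu>)" by simp
    ultimately show ?thesis by presburger
  qed
  finally show "L2_set (\<lambda>i. P i * W i - \<mu>') I \<le> 27 / 100 * \<mu>'" .
qed

text \<open>
  For the Newton step the linear terms cancel, \<open>(p + u) (w + v) = \<mu> + u v\<close>, so the new distance from
  the central path is that of \<open>u v\<close> from its mean.  The energy of the step is at most
  \<open>0.27\<^sup>2 / 0.73 \<mu> < \<mu> / 10\<close>, hence \<open>\<Sum> \<bar>u v\<bar> \<le> \<mu> / 20\<close>.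
\<close>

lemma corrector_estimates:
  fixes p w u v :: "nat \<Rightarrow> real" and n :: nat
  defines "I \<equiv> {..<2 * n}"
    and "\<mu> \<equiv> (\<Sum>i<2*n. p i * w i) / (2 * real n)"
    and "\<mu>' \<equiv> (\<Sum>i<2*n. (p i + u i) * (w i + v i)) / (2 * real n)"
  assumes n: "1 \<le> n"
    and pos: "\<And>i. i \<in> I \<Longrightarrow> 0 < p i" "\<And>i. i \<in> I \<Longrightarrow> 0 < w i"
    and near: "L2_set (\<lambda>i. p i * w i - \<mu>) I \<le> 27 / 100 * \<mu>"
    and dir: "\<And>i. i \<in> I \<Longrightarrow> w i * u i + p i * v i = \<mu> - w i * p i"
    and nonneg: "0 \<le> (\<Sum>i\<in>I. u i * v i)"
  shows "\<And>i. i \<in> I \<Longrightarrow> 0 < p i + u i" "\<And>i. i \<in> I \<Longrightarrow> 0 < w i + v i"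
    and "\<mu>' \<le> \<mu> * (1 + 1 / (40 * real n))"
    and "L2_set (\<lambda>i. (p i + u i) * (w i + v i) - \<mu>') I \<le> 19 / 100 * \<mu>'"
proof -
  have fin: "finite I" and ne: "I \<noteq> {}" and card: "real (card I) = 2 * real n"
    using n by (auto simp: I_def lessThan_empty_iff)
  have "0 < (\<Sum>i\<in>I. p i * w i)" using pos fin ne by (intro sum_pos) auto
  then have mu: "0 < \<mu>" using n by (simp add: \<mu>_def I_def zero_less_mult_iff)
  have lower: "73 / 100 * \<mu> \<le> p i * w i" if "i \<in> I" for i
    using abs_le_L2_set[OF fin that, of "\<lambda>i. p i * w i - \<mu>"] near by simp
  have E: "scaled_energy I p w u v \<le> \<mu> / 10"
  proof -
    have "scaled_energy I p w u v \<le> (\<Sum>i\<in>I. (\<mu> - w i * p i)\<^sup>2 / (p i * w i))"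
      by (rule scaled_energy_le[OF pos dir nonneg])
    also have "\<dots> \<le> (\<Sum>i\<in>I. (p i * w i - \<mu>)\<^sup>2 / (73 / 100 * \<mu>))"
    proof (rule sum_mono)
      fix i assume i: "i \<in> I"
      have "(p i * w i - \<mu>)\<^sup>2 / (p i * w i) \<le> (p i * w i - \<mu>)\<^sup>2 / (73 / 100 * \<mu>)"
        using lower[OF i] mu by (intro divide_left_mono) (auto simp: pos i)
      then show "(\<mu> - w i * p i)\<^sup>2 / (p i * w i) \<le> (p i * w i - \<mu>)\<^sup>2 / (73 / 100 * \<mu>)"
        by (simp add: power2_commute mult.commute)
    qed
    also have "\<dots> = (L2_set (\<lambda>i. p i * w i - \<mu>) I)\<^sup>2 / (73 / 100 * \<mu>)"
      by (simp only: sum_divide_distrib[symmetric]) (simp add: L2_set_def sum_nonneg)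
    also have "\<dots> \<le> (27 / 100 * \<mu>)\<^sup>2 / (73 / 100 * \<mu>)"
      using near mu by (intro divide_right_mono power_mono) auto
    also have "\<dots> \<le> \<mu> / 10" using mu by (simp add: power2_eq_square)
    finally show ?thesis .
  qed
  show "0 < p i + u i" "0 < w i + v i" if i: "i \<in> I" for i
  proof -
    have "scaled_energy I p w u v \<le> (1 / 2)\<^sup>2 * (73 / 100 * \<mu>)"
      using E mu by (simp add: power2_eq_square)
    from relative_direction_le[OF fin pos i this lower[OF i]]
    have "\<bar>u i\<bar> \<le> 1 / 2 * p i" "\<bar>v i\<bar> \<le> 1 / 2 * w i" by auto
    then show "0 < p i + u i" "0 < w i + v i" using pos[OF i] by auto
  qed
  have "(\<Sum>i\<in>I. \<bar>u i * v i\<bar>) \<le> scaled_energy I p w u v / 2"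
    by (intro sum_abs_prod_le pos)
  then have uv: "(\<Sum>i\<in>I. \<bar>u i * v i\<bar>) \<le> \<mu> / 20"
    using E by simp
  have prod: "(p i + u i) * (w i + v i) = \<mu> + u i * v i" if "i \<in> I" for i
    using dir[OF that] by (simp add: algebra_simps)
  have "(\<Sum>i\<in>I. (p i + u i) * (w i + v i)) = 2 * real n * \<mu> + (\<Sum>i\<in>I. u i * v i)"
    by (simp add: prod sum.distrib card)
  then have mu'_eq: "\<mu>' = \<mu> + (\<Sum>i\<in>I. u i * v i) / card I"
    unfolding card \<mu>'_def I_def using n by (simp add: add_divide_distrib)
  have "(\<Sum>i\<in>I. u i * v i) \<le> (\<Sum>i\<in>I. \<bar>u i * v i\<bar>)" by (intro sum_mono) auto
  with uv have "(\<Sum>i\<in>I. u i * v i) / card I \<le> \<mu> / 20 / card I"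
    by (intro divide_right_mono) auto
  then show "\<mu>' \<le> \<mu> * (1 + 1 / (40 * real n))"
    unfolding mu'_eq card by (simp add: distrib_left)
  have mu'_ge: "\<mu> \<le> \<mu>'" using nonneg by (simp add: mu'_eq)
  have "L2_set (\<lambda>i. (p i + u i) * (w i + v i) - \<mu>') I
      = L2_set (\<lambda>i. u i * v i - (\<Sum>j\<in>I. u j * v j) / card I) I"
    by (rule L2_set_cong) (auto simp: prod mu'_eq)
  also have "\<dots> \<le> 2 * (\<mu> / 20)"
    using L2_set_centred_le[OF fin ne, of "\<lambda>i. u i * v i"] uv by linarith
  also have "\<dots> \<le> 19 / 100 * \<mu>'" using mu mu'_ge by simp
  finally show "L2_set (\<lambda>i. (p i + u i) * (w i + v i) - \<mu>') I \<le> 19 / 100 * \<mu>'" .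
qed

section \<open>Solvability of the linear systems\<close>

lemma pos_def_system_ex1:
  fixes A :: "real mat"
  assumes A: "A \<in> carrier_mat n n" and b: "b \<in> carrier_vec n"
    and pos: "\<And>v. v \<in> carrier_vec n \<Longrightarrow> v \<noteq> 0\<^sub>v n \<Longrightarrow> 0 < v \<bullet> (A *\<^sub>v v)"
  shows "\<exists>!x. x \<in> carrier_vec n \<and> A *\<^sub>v x = b"
proof -
  have "det A \<noteq> 0"
    unfolding det_0_iff_vec_prod_zero_field[OF A]
  proof safe
    fix v assume "v \<in> carrier_vec n" "v \<noteq> 0\<^sub>v n" "A *\<^sub>v v = 0\<^sub>v n"
    with pos[of v] show False by simp
  qed
  from det_non_zero_imp_unit[OF A this, unfolded Units_def, of "()"]
  obtain B where B: "B \<in> carrier_mat n n" "B * A = 1\<^sub>m n" "A * B = 1\<^sub>m n"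
    by (auto simp: ring_mat_def)
  have "A *\<^sub>v (B *\<^sub>v b) = b"
    by (metis A B(1,3) b assoc_mult_mat_vec one_mult_mat_vec)
  moreover have "x = B *\<^sub>v (A *\<^sub>v x)" if "x \<in> carrier_vec n" for x
    by (metis A B(1,2) that assoc_mult_mat_vec one_mult_mat_vec)
  ultimately show ?thesis
    using B(1) b by (intro ex1I[of _ "B *\<^sub>v b"]) (auto simp: mult_mat_vec_carrier)
qed

lemma direction_system_iff_components:
  assumes "H \<in> carrier_mat n n" "v \<in> qp_carrier n" "dim_vec r = n" "dim_vec s = n"
  shows "direction_system n H v r s d \<longleftrightarrow> d \<in> qp_carrier n \<and>
    (\<forall>i<n. (H *\<^sub>v xc d) $ i + lamc d $ i - gamc d $ i = 0 \<and>
      xc d $ i + yc d $ i = 0 \<and> xc d $ i - zc d $ i = 0 \<and>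
      lamc v $ i * yc d $ i + yc v $ i * lamc d $ i = r $ i \<and>
      gamc v $ i * zc d $ i + zc v $ i * gamc d $ i = s $ i)"
  using assms
  by (auto simp: direction_system_def qp_carrier_def vec_eq_iff index_component_mult
      dim_component_mult simp del: index_mult_mat_vec)

text \<open>
  Eliminating \<open>dy = - dx\<close>, \<open>dz = dx\<close> and, through the complementarity equations, \<open>d\<lambda>\<close> and \<open>d\<gamma>\<close>
  leaves the system \<open>(H + D) dx = b\<close> with the positive diagonal \<open>D = \<lambda> / y + \<gamma> / z\<close>.
\<close>

lemma direction_system_ex1:
  assumes H: "sym_pos_def n H" and v: "v \<in> qp_carrier n"
    and pos: "pos_vec (yc v)" "pos_vec (zc v)" "pos_vec (lamc v)" "pos_vec (gamc v)"
    and dim: "dim_vec r = n" "dim_vec s = n"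
  shows "\<exists>!d. direction_system n H v r s d"
proof -
  have Hc: "H \<in> carrier_mat n n" using H by (simp add: sym_pos_def_def)
  have vdim: "dim_vec (yc v) = n" "dim_vec (zc v) = n" "dim_vec (lamc v) = n" "dim_vec (gamc v) = n"
    using v by (auto simp: qp_carrier_def)
  have posi: "0 < yc v $ i" "0 < zc v $ i" "0 < lamc v $ i" "0 < gamc v $ i" if "i < n" for i
    using pos vdim that by (auto simp: pos_vec_def)
  define D where "D = (\<lambda>i. lamc v $ i / yc v $ i + gamc v $ i / zc v $ i)"
  define A where "A = H + mat n n (\<lambda>(i, j). if i = j then D i else 0)"
  define b where "b = vec n (\<lambda>i. s $ i / zc v $ i - r $ i / yc v $ i)"
  define lift where "lift x = \<lparr>xc = x, yc = - x, zc = x,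
    lamc = vec n (\<lambda>i. (r $ i + lamc v $ i * x $ i) / yc v $ i),
    gamc = vec n (\<lambda>i. (s $ i - gamc v $ i * x $ i) / zc v $ i)\<rparr>" for x
  have Ac: "A \<in> carrier_mat n n" using Hc by (simp add: A_def)
  have bc: "b \<in> carrier_vec n" by (simp add: b_def)
  have A_index: "(A *\<^sub>v x) $ i = (H *\<^sub>v x) $ i + D i * x $ i"
    if "i < n" "x \<in> carrier_vec n" for i x
  proof -
    have "(\<Sum>j = 0..<n. (if i = j then D i else 0) * x $ j) = D i * x $ i"
      using that by (simp add: if_distrib[of "\<lambda>a. a * _"] cong: if_cong)
    then have "(mat n n (\<lambda>(i, j). if i = j then D i else 0) *\<^sub>v x) $ i = D i * x $ i"
      using that by (auto simp: scalar_prod_def)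
    then show ?thesis
      using that Hc by (simp add: A_def add_mult_distrib_mat_vec[OF Hc] del: index_mult_mat_vec)
  qed
  have "0 < x \<bullet> (A *\<^sub>v x)" if x: "x \<in> carrier_vec n" "x \<noteq> 0\<^sub>v n" for x
  proof -
    have "x \<bullet> (A *\<^sub>v x) = x \<bullet> (H *\<^sub>v x) + (\<Sum>i = 0..<n. D i * (x $ i)\<^sup>2)"
      using x Ac Hc
      by (simp add: scalar_prod_def[of x] A_index sum.distrib[symmetric] power2_eq_square
          algebra_simps del: index_mult_mat_vec)
    moreover have "0 \<le> (\<Sum>i = 0..<n. D i * (x $ i)\<^sup>2)"
      using posi by (intro sum_nonneg) (auto simp: D_def less_imp_le)
    moreover have "0 < x \<bullet> (H *\<^sub>v x)" using H x by (simp add: sym_pos_def_def)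
    ultimately show ?thesis by simp
  qed
  from pos_def_system_ex1[OF Ac bc this]
  have ex1: "\<exists>!x. x \<in> carrier_vec n \<and> A *\<^sub>v x = b" .
  have iff: "direction_system n H v r s d \<longleftrightarrow>
      (xc d \<in> carrier_vec n \<and> A *\<^sub>v xc d = b) \<and> d = lift (xc d)" for d
  proof
    assume d: "direction_system n H v r s d"
    then have dc: "d \<in> qp_carrier n" by (simp add: direction_system_def)
    have eqs: "(H *\<^sub>v xc d) $ i + lamc d $ i - gamc d $ i = 0"
      "yc d $ i = - xc d $ i" "zc d $ i = xc d $ i"
      "lamc d $ i = (r $ i + lamc v $ i * xc d $ i) / yc v $ i"
      "gamc d $ i = (s $ i - gamc v $ i * xc d $ i) / zc v $ i" if "i < n" for i
    proof -
      have *: "(H *\<^sub>v xc d) $ i + lamc d $ i - gamc d $ i = 0"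
        "xc d $ i + yc d $ i = 0" "xc d $ i - zc d $ i = 0"
        "lamc v $ i * yc d $ i + yc v $ i * lamc d $ i = r $ i"
        "gamc v $ i * zc d $ i + zc v $ i * gamc d $ i = s $ i"
        using d that by (auto simp: direction_system_iff_components[OF Hc v dim])
      then show **: "(H *\<^sub>v xc d) $ i + lamc d $ i - gamc d $ i = 0"
        "yc d $ i = - xc d $ i" "zc d $ i = xc d $ i" by auto
      show "lamc d $ i = (r $ i + lamc v $ i * xc d $ i) / yc v $ i"
        using *(4) posi[OF that] unfolding **(2) by (simp add: field_simps)
      show "gamc d $ i = (s $ i - gamc v $ i * xc d $ i) / zc v $ i"
        using *(5) posi[OF that] unfolding **(3) by (simp add: field_simps)
    qed
    have "(A *\<^sub>v xc d) $ i = b $ i" if "i < n" for i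
      using eqs(1)[OF that] posi[OF that] dc that unfolding eqs(4,5)[OF that]
      by (simp add: A_index qp_carrier_def b_def D_def diff_divide_distrib add_divide_distrib
          algebra_simps del: index_mult_mat_vec)
    then have "A *\<^sub>v xc d = b" using Ac by (auto simp: vec_eq_iff b_def simp del: index_mult_mat_vec)
    moreover have "d = lift (xc d)"
      using dc eqs by (cases d) (auto simp: lift_def qp_carrier_def vec_eq_iff)
    ultimately show "(xc d \<in> carrier_vec n \<and> A *\<^sub>v xc d = b) \<and> d = lift (xc d)"
      using dc by (simp add: qp_carrier_def)
  next
    assume d: "(xc d \<in> carrier_vec n \<and> A *\<^sub>v xc d = b) \<and> d = lift (xc d)"
    define x where "x = xc d"
    have x: "x \<in> carrier_vec n" "d = lift x" "A *\<^sub>v x = b"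
      using d unfolding x_def by blast+
    have "(H *\<^sub>v x) $ i + (r $ i + lamc v $ i * x $ i) / yc v $ i
      - (s $ i - gamc v $ i * x $ i) / zc v $ i = 0" if "i < n" for i
    proof -
      have "(A *\<^sub>v x) $ i = b $ i" by (simp only: x)
      then show ?thesis using that x(1)
        by (simp add: A_index b_def D_def diff_divide_distrib add_divide_distrib
            algebra_simps del: index_mult_mat_vec)
    qed
    then show "direction_system n H v r s d"
      unfolding direction_system_iff_components[OF Hc v dim] x(2)
      using x posi by (auto simp: lift_def qp_carrier_def less_imp_neq[symmetric]
          simp del: index_mult_mat_vec)
  qed
  have "xc (lift x) = x" for x by (simp add: lift_def)
  with ex1 show ?thesis
    unfolding iff by metis
qed

section \<open>Feasibility and the stacked coordinates\<close>

text \<open>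
  The affine part of feasibility and its linear counterpart are separated from positivity, because they
  are preserved by every step regardless of its length.
\<close>

definition equality_feasible :: "nat \<Rightarrow> real mat \<Rightarrow> real vec \<Rightarrow> qp_point \<Rightarrow> bool" where
  "equality_feasible n H c v \<longleftrightarrow> v \<in> qp_carrier n \<and>
     H *\<^sub>v xc v + c + lamc v - gamc v = 0\<^sub>v n \<and>
     xc v + yc v = ones_vec n \<and> xc v - zc v = - ones_vec n"

definition homogeneous :: "nat \<Rightarrow> real mat \<Rightarrow> qp_point \<Rightarrow> bool" where
  "homogeneous n H d \<longleftrightarrow> d \<in> qp_carrier n \<and>
     H *\<^sub>v xc d + lamc d - gamc d = 0\<^sub>v n \<and> xc d + yc d = 0\<^sub>v n \<and> xc d - zc d = 0\<^sub>v n"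

lemma homogeneous_if_direction_system: "direction_system n H v r s d \<Longrightarrow> homogeneous n H d"
  by (simp add: direction_system_def homogeneous_def)


definition scale_point :: "real \<Rightarrow> qp_point \<Rightarrow> qp_point" where
  "scale_point a d = \<lparr>xc = a \<cdot>\<^sub>v xc d, yc = a \<cdot>\<^sub>v yc d, zc = a \<cdot>\<^sub>v zc d,
     lamc = a \<cdot>\<^sub>v lamc d, gamc = a \<cdot>\<^sub>v gamc d\<rparr>"

text \<open>
  The arc point arises by adding two scaled directions, so that feasibility has to be
  checked for a single addition only.
\<close>

lemma arc_point_eq_add_point:
  assumes "v \<in> qp_carrier n" "d \<in> qp_carrier n" "dd \<in> qp_carrier n"
  shows "arc_point \<alpha> v d dd
    = add_point (add_point v (scale_point (- sin \<alpha>) d)) (scale_point (1 - cos \<alpha>) dd)"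
  using assms by (auto simp: arc_point_def add_point_def scale_point_def arc_vec_def qp_carrier_def)

lemma homogeneous_scale_point:
  assumes H: "H \<in> carrier_mat n n" and d: "homogeneous n H d"
  shows "homogeneous n H (scale_point a d)"
proof -
  have carr: "xc d \<in> carrier_vec n" "yc d \<in> carrier_vec n" "zc d \<in> carrier_vec n"
    "lamc d \<in> carrier_vec n" "gamc d \<in> carrier_vec n"
    using d by (auto simp: homogeneous_def qp_carrier_def)
  have "H *\<^sub>v (a \<cdot>\<^sub>v xc d) + a \<cdot>\<^sub>v lamc d - a \<cdot>\<^sub>v gamc d = a \<cdot>\<^sub>v (H *\<^sub>v xc d + lamc d - gamc d)"
    using carr H by (intro eq_vecI) (auto simp: mult_mat_vec[OF H carr(1)] algebra_simps
        simp del: index_mult_mat_vec)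
  moreover have "a \<cdot>\<^sub>v xc d + a \<cdot>\<^sub>v yc d = a \<cdot>\<^sub>v (xc d + yc d)"
    "a \<cdot>\<^sub>v xc d - a \<cdot>\<^sub>v zc d = a \<cdot>\<^sub>v (xc d - zc d)"
    using carr by (auto simp: algebra_simps)
  ultimately show ?thesis
    using d by (auto simp: homogeneous_def scale_point_def qp_carrier_def)
qed

lemma equality_feasible_add_point:
  assumes H: "H \<in> carrier_mat n n" and c: "c \<in> carrier_vec n"
    and v: "equality_feasible n H c v" and d: "homogeneous n H d"
  shows "equality_feasible n H c (add_point v d)"
proof -
  have carr: "xc d \<in> carrier_vec n" "yc d \<in> carrier_vec n" "zc d \<in> carrier_vec n"
    "lamc d \<in> carrier_vec n" "gamc d \<in> carrier_vec n"
    "xc v \<in> carrier_vec n" "yc v \<in> carrier_vec n" "zc v \<in> carrier_vec n"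
    "lamc v \<in> carrier_vec n" "gamc v \<in> carrier_vec n"
    using v d by (auto simp: homogeneous_def equality_feasible_def qp_carrier_def)
  have "H *\<^sub>v (xc v + xc d) + c + (lamc v + lamc d) - (gamc v + gamc d)
      = (H *\<^sub>v xc v + c + lamc v - gamc v) + (H *\<^sub>v xc d + lamc d - gamc d)"
    using carr H c by (intro eq_vecI) (auto simp: mult_add_distrib_mat_vec[OF H carr(6,1)]
        simp del: index_mult_mat_vec)
  moreover have "(xc v + xc d) + (yc v + yc d) = (xc v + yc v) + (xc d + yc d)"
    using carr by (intro eq_vecI) auto
  moreover have "(xc v + xc d) - (zc v + zc d) = (xc v - zc v) + (xc d - zc d)"
    using carr by (intro eq_vecI) auto
  ultimately show ?thesis
    using v d by (auto simp: homogeneous_def equality_feasible_def add_point_def qp_carrier_def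
        ones_vec_def)
qed

lemma equality_feasible_arc_point:
  assumes H: "H \<in> carrier_mat n n" and c: "c \<in> carrier_vec n"
    and v: "equality_feasible n H c v" and d: "homogeneous n H d" and dd: "homogeneous n H dd"
  shows "equality_feasible n H c (arc_point \<alpha> v d dd)"
proof -
  have "v \<in> qp_carrier n" "d \<in> qp_carrier n" "dd \<in> qp_carrier n"
    using v d dd by (auto simp: equality_feasible_def homogeneous_def)
  then show ?thesis
    by (simp add: arc_point_eq_add_point equality_feasible_add_point homogeneous_scale_point
        H c v d dd)
qed

lemma pvec_index: "v \<in> qp_carrier n \<Longrightarrow> i < 2 * n \<Longrightarrow>
    pvec v $ i = (if i < n then yc v $ i else zc v $ (i - n))"
  and omvec_index: "v \<in> qp_carrier n \<Longrightarrow> i < 2 * n \<Longrightarrow>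
    omvec v $ i = (if i < n then lamc v $ i else gamc v $ (i - n))"
  and dim_pvec: "v \<in> qp_carrier n \<Longrightarrow> dim_vec (pvec v) = 2 * n"
  and dim_omvec: "v \<in> qp_carrier n \<Longrightarrow> dim_vec (omvec v) = 2 * n"
  by (auto simp: pvec_def omvec_def qp_carrier_def)

lemma all_less_double_iff:
  "(\<forall>i<2*n. P i) \<longleftrightarrow> (\<forall>i<n. P i) \<and> (\<forall>i<n. P (n + i))" for n :: nat
proof safe
  fix i assume "\<forall>i<n. P i" "\<forall>i<n. P (n + i)" "i < 2 * n"
  then show "P i"
    by (cases "i < n") (auto dest: spec[of _ "i - n"])
qed auto

lemma gap_eq_sum:
  assumes "v \<in> qp_carrier n"
  shows "gap n v = (\<Sum>i<2*n. pvec v $ i * omvec v $ i) / (2 * real n)"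
  using assms by (simp add: gap_def scalar_prod_def dim_omvec atLeast0LessThan)

text \<open>
  In the coordinates of the stacked vectors \<open>p\<close> and \<open>\<omega>\<close> the blocks for the upper and the lower bounds are
  treated alike.
\<close>

lemma N2_iff:
  "v \<in> N2 n H c \<theta> \<longleftrightarrow> equality_feasible n H c v \<and>
    (\<forall>i<2*n. 0 < pvec v $ i \<and> 0 < omvec v $ i) \<and>
    L2_set (\<lambda>i. pvec v $ i * omvec v $ i - gap n v) {..<2*n} \<le> \<theta> * gap n v"
proof (cases "v \<in> qp_carrier n")
  case True
  have "vnorm (pvec v \<circ>\<^sub>v omvec v - gap n v \<cdot>\<^sub>v ones_vec (2 * n))
      = L2_set (\<lambda>i. pvec v $ i * omvec v $ i - gap n v) {..<2*n}"
    using True by (simp add: vnorm_def L2_set_def scalar_prod_def ones_vec_def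
        index_component_mult dim_pvec dim_omvec atLeast0LessThan power2_eq_square)
  moreover have "(\<forall>i<2*n. 0 < pvec v $ i \<and> 0 < omvec v $ i) \<longleftrightarrow>
      pos_vec (yc v) \<and> pos_vec (zc v) \<and> pos_vec (lamc v) \<and> pos_vec (gamc v)"
    using True by (auto simp: all_less_double_iff pvec_index omvec_index pos_vec_def qp_carrier_def)
  ultimately show ?thesis
    by (auto simp: N2_def interior_feasible_def equality_feasible_def)
qed (auto simp: N2_def interior_feasible_def equality_feasible_def)

lemma direction_system_stacked:
  assumes "H \<in> carrier_mat n n" "v \<in> qp_carrier n" "dim_vec r = n" "dim_vec s = n"
    and "direction_system n H v r s d" "i < 2 * n"
  shows "omvec v $ i * pvec d $ i + pvec v $ i * omvec d $ i = (r @\<^sub>v s) $ i"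
  using assms by (auto simp: direction_system_iff_components pvec_index omvec_index)

text \<open>
  From \<open>dy = - dx\<close>, \<open>dz = dx\<close> and \<open>d\<gamma> - d\<lambda> = H dx\<close> the sum equals \<open>dx \<bullet> H dx\<close>.
\<close>

lemma homogeneous_prod_nonneg:
  assumes H: "sym_pos_def n H" and d: "homogeneous n H d"
  shows "0 \<le> (\<Sum>i<2*n. pvec d $ i * omvec d $ i)"
proof -
  have carr: "xc d \<in> carrier_vec n" "yc d \<in> carrier_vec n" "zc d \<in> carrier_vec n"
    "lamc d \<in> carrier_vec n" "gamc d \<in> carrier_vec n" "d \<in> qp_carrier n"
    using d by (auto simp: homogeneous_def qp_carrier_def)
  have Hc: "H \<in> carrier_mat n n" using H by (simp add: sym_pos_def_def)
  have "(\<Sum>i<2*n. pvec d $ i * omvec d $ i) = yc d \<bullet> lamc d + zc d \<bullet> gamc d"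
    using scalar_prod_append[OF carr(2-5), folded pvec_def omvec_def] carr(6)
    by (simp add: scalar_prod_def[of "pvec d"] dim_omvec atLeast0LessThan)
  also have "\<dots> = (\<Sum>i<n. yc d $ i * lamc d $ i + zc d $ i * gamc d $ i)"
    using carr by (simp add: scalar_prod_def sum.distrib atLeast0LessThan)
  also have "\<dots> = (\<Sum>i<n. xc d $ i * (H *\<^sub>v xc d) $ i)"
  proof (rule sum.cong)
    fix i assume "i \<in> {..<n}"
    then have "(H *\<^sub>v xc d) $ i + lamc d $ i - gamc d $ i = 0"
      "xc d $ i + yc d $ i = 0" "xc d $ i - zc d $ i = 0"
      using d Hc carr by (auto simp: homogeneous_def vec_eq_iff simp del: index_mult_mat_vec)
    then have "(H *\<^sub>v xc d) $ i = gamc d $ i - lamc d $ i" "yc d $ i = - xc d $ i"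
      "zc d $ i = xc d $ i" by linarith+
    then show "yc d $ i * lamc d $ i + zc d $ i * gamc d $ i = xc d $ i * (H *\<^sub>v xc d) $ i"
      by (simp add: right_diff_distrib)
  qed simp
  also have "\<dots> = xc d \<bullet> (H *\<^sub>v xc d)"
    using Hc carr by (simp add: scalar_prod_def[of "xc d"] atLeast0LessThan del: index_mult_mat_vec)
  also have "\<dots> \<ge> 0"
  proof (cases "xc d = 0\<^sub>v n")
    case True
    then show ?thesis using Hc by (simp add: mult_mat_vec_carrier)
  next
    case False
    then show ?thesis using H carr by (simp add: sym_pos_def_def less_imp_le)
  qed
  finally show ?thesis .
qed

section \<open>One iteration\<close>

lemma predictor_step:
  assumes n: "1 \<le> n" and H: "sym_pos_def n H" and c: "c \<in> carrier_vec n"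
    and v: "v \<in> N2 n H c (19 / 100)"
    and d: "first_direction n H v d" and dd: "second_direction n H v d dd"
    and \<alpha>: "0 \<le> \<alpha>" "\<alpha> \<le> pi / 2" "sin \<alpha> = 19 / 100 / sqrt n"
  shows "arc_point \<alpha> v d dd \<in> N2 n H c (27 / 100)"
    and "0 < gap n v"
    and "\<bar>gap n (arc_point \<alpha> v d dd) - (1 - sin \<alpha>) * gap n v\<bar> \<le> 27 / 2000 * gap n v / n"
proof -
  have Hc: "H \<in> carrier_mat n n" using H by (simp add: sym_pos_def_def)
  have feas: "equality_feasible n H c v" using v by (simp add: N2_iff)
  have hom: "homogeneous n H d" "homogeneous n H dd"
    using d dd by (auto simp: first_direction_def second_direction_def
        intro: homogeneous_if_direction_system)
  define a where "a = arc_point \<alpha> v d dd"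
  have a: "equality_feasible n H c a"
    unfolding a_def by (rule equality_feasible_arc_point[OF Hc c feas hom])
  have carr: "v \<in> qp_carrier n" "d \<in> qp_carrier n" "dd \<in> qp_carrier n" "a \<in> qp_carrier n"
    using feas hom a by (auto simp: equality_feasible_def homogeneous_def)
  have dims: "dim_vec (yc u) = n" "dim_vec (zc u) = n" "dim_vec (lamc u) = n"
    "dim_vec (gamc u) = n" if "u \<in> qp_carrier n" for u
    using that by (auto simp: qp_carrier_def)
  have a_index: "pvec a $ i = pvec v $ i - sin \<alpha> * pvec d $ i + (1 - cos \<alpha>) * pvec dd $ i"
    "omvec a $ i = omvec v $ i - sin \<alpha> * omvec d $ i + (1 - cos \<alpha>) * omvec dd $ i"
    if "i < 2 * n" for i
    using that carr by (auto simp: pvec_index omvec_index a_def arc_point_def arc_vec_def dims)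
  have first: "omvec v $ i * pvec d $ i + pvec v $ i * omvec d $ i = omvec v $ i * pvec v $ i"
    if "i < 2 * n" for i
    using direction_system_stacked[OF Hc carr(1) _ _ d[unfolded first_direction_def] that] that carr
    by (auto simp: dim_component_mult index_component_mult dims pvec_index omvec_index)
  have second: "omvec v $ i * pvec dd $ i + pvec v $ i * omvec dd $ i
      = - 2 * (omvec d $ i * pvec d $ i)" if "i < 2 * n" for i
    using direction_system_stacked[OF Hc carr(1) _ _ dd[unfolded second_direction_def] that] that carr
    by (auto simp: dim_component_mult index_component_mult dims pvec_index omvec_index)
  note est = predictor_estimates[of n "($) (pvec v)" "($) (omvec v)" "($) (pvec d)" "($) (omvec d)"
      "($) (pvec dd)" "($) (omvec dd)" \<alpha>]
  have gap_a: "gap n a = (\<Sum>i<2*n.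
      (pvec v $ i - sin \<alpha> * pvec d $ i + (1 - cos \<alpha>) * pvec dd $ i) *
      (omvec v $ i - sin \<alpha> * omvec d $ i + (1 - cos \<alpha>) * omvec dd $ i)) / (2 * real n)"
    by (simp add: gap_eq_sum carr a_index)
  have prem: "L2_set (\<lambda>i. pvec v $ i * omvec v $ i - gap n v) {..<2*n} \<le> 19 / 100 * gap n v"
    "\<And>i. i \<in> {..<2*n} \<Longrightarrow> 0 < pvec v $ i" "\<And>i. i \<in> {..<2*n} \<Longrightarrow> 0 < omvec v $ i"
    using v by (auto simp: N2_iff)
  note est' = est[folded gap_eq_sum[OF carr(1)] gap_a, OF n prem(2,3,1) first second
      homogeneous_prod_nonneg[OF H hom(1)] homogeneous_prod_nonneg[OF H hom(2)] \<alpha>]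
  show "0 < gap n v" by (rule est'(1)) auto
  show "\<bar>gap n (arc_point \<alpha> v d dd) - (1 - sin \<alpha>) * gap n v\<bar> \<le> 27 / 2000 * gap n v / n"
    unfolding a_def[symmetric] by (rule est'(4)) auto
  have "L2_set (\<lambda>i. pvec a $ i * omvec a $ i - gap n a) {..<2*n} = L2_set (\<lambda>i.
      (pvec v $ i - sin \<alpha> * pvec d $ i + (1 - cos \<alpha>) * pvec dd $ i) *
      (omvec v $ i - sin \<alpha> * omvec d $ i + (1 - cos \<alpha>) * omvec dd $ i) - gap n a) {..<2*n}"
    by (rule L2_set_cong) (auto simp: a_index)
  also have "\<dots> \<le> 27 / 100 * gap n a" by (rule est'(5)) auto
  finally have near: "L2_set (\<lambda>i. pvec a $ i * omvec a $ i - gap n a) {..<2*n}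
      \<le> 27 / 100 * gap n a" .
  have "0 < pvec a $ i" "0 < omvec a $ i" if "i < 2 * n" for i
    using est'(2)[of i] est'(3)[of i] that unfolding a_index[OF that] by auto
  with near a show "arc_point \<alpha> v d dd \<in> N2 n H c (27 / 100)"
    unfolding a_def[symmetric] N2_iff by blast
qed

lemma corrector_step:
  assumes n: "1 \<le> n" and H: "sym_pos_def n H" and c: "c \<in> carrier_vec n"
    and a: "a \<in> N2 n H c (27 / 100)" and d: "corrector_direction n H a d"
  shows "add_point a d \<in> N2 n H c (19 / 100)"
    and "gap n (add_point a d) \<le> gap n a * (1 + 1 / (40 * real n))"
proof -
  have Hc: "H \<in> carrier_mat n n" using H by (simp add: sym_pos_def_def)
  have feas: "equality_feasible n H c a" using a by (simp add: N2_iff)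
  have hom: "homogeneous n H d"
    using d by (auto simp: corrector_direction_def intro: homogeneous_if_direction_system)
  define b where "b = add_point a d"
  have b: "equality_feasible n H c b"
    unfolding b_def by (rule equality_feasible_add_point[OF Hc c feas hom])
  have carr: "a \<in> qp_carrier n" "d \<in> qp_carrier n" "b \<in> qp_carrier n"
    using feas hom b by (auto simp: equality_feasible_def homogeneous_def)
  have dims: "dim_vec (yc u) = n" "dim_vec (zc u) = n" "dim_vec (lamc u) = n"
    "dim_vec (gamc u) = n" if "u \<in> qp_carrier n" for u
    using that by (auto simp: qp_carrier_def)
  have b_index: "pvec b $ i = pvec a $ i + pvec d $ i" "omvec b $ i = omvec a $ i + omvec d $ i"
    if "i < 2 * n" for i
    using that carr by (auto simp: pvec_index omvec_index b_def add_point_def dims)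
  have dir: "omvec a $ i * pvec d $ i + pvec a $ i * omvec d $ i
      = gap n a - omvec a $ i * pvec a $ i" if "i < 2 * n" for i
    using direction_system_stacked[OF Hc carr(1) _ _ d[unfolded corrector_direction_def] that]
      that carr
    by (auto simp: dim_component_mult index_component_mult dims pvec_index omvec_index ones_vec_def)
  note est = corrector_estimates[of n "($) (pvec a)" "($) (omvec a)" "($) (pvec d)" "($) (omvec d)"]
  have gap_b: "gap n b = (\<Sum>i<2*n. (pvec a $ i + pvec d $ i) * (omvec a $ i + omvec d $ i))
      / (2 * real n)"
    by (simp add: gap_eq_sum carr b_index)
  have prem: "L2_set (\<lambda>i. pvec a $ i * omvec a $ i - gap n a) {..<2*n} \<le> 27 / 100 * gap n a"
    "\<And>i. i \<in> {..<2*n} \<Longrightarrow> 0 < pvec a $ i" "\<And>i. i \<in> {..<2*n} \<Longrightarrow> 0 < omvec a $ i"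
    using a by (auto simp: N2_iff)
  note est' = est[folded gap_eq_sum[OF carr(1)] gap_b, OF n prem(2,3,1) dir
      homogeneous_prod_nonneg[OF H hom]]
  show "gap n (add_point a d) \<le> gap n a * (1 + 1 / (40 * real n))"
    unfolding b_def[symmetric] by (rule est'(3)) auto
  have "L2_set (\<lambda>i. pvec b $ i * omvec b $ i - gap n b) {..<2*n} = L2_set (\<lambda>i.
      (pvec a $ i + pvec d $ i) * (omvec a $ i + omvec d $ i) - gap n b) {..<2*n}"
    by (rule L2_set_cong) (auto simp: b_index)
  also have "\<dots> \<le> 19 / 100 * gap n b" by (rule est'(4)) auto
  finally have near: "L2_set (\<lambda>i. pvec b $ i * omvec b $ i - gap n b) {..<2*n}
      \<le> 19 / 100 * gap n b" .
  have "0 < pvec b $ i" "0 < omvec b $ i" if "i < 2 * n" for i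
    using est'(1)[of i] est'(2)[of i] that unfolding b_index[OF that] by auto
  with near b show "add_point a d \<in> N2 n H c (19 / 100)"
    unfolding b_def[symmetric] N2_iff by blast
qed

text \<open>
  With \<open>u = 1 / sqrt n\<close> the factor is at most \<open>(1 - 0.19 u + 0.0135 u\<^sup>2) (1 + u\<^sup>2 / 40)\<close>.  As \<open>u\<^sup>2 \<le> u\<close>,
  the quadratic terms take away at most \<open>0.0385 u\<close> of the decrease \<open>0.19 u\<close>.
\<close>

lemma arc_search_step_contracts:
  assumes n: "1 \<le> n" and H: "sym_pos_def n H" and c: "c \<in> carrier_vec n"
    and v: "v \<in> N2 n H c (19 / 100)" and step: "arc_search_step n H (19 / 100) v v'"
  shows "v' \<in> N2 n H c (19 / 100)" "gap n v' \<le> (1 - 3 / (20 * sqrt n)) * gap n v"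
proof -
  from step obtain d dd \<alpha> \<Delta> where
    d: "first_direction n H v d" and dd: "second_direction n H v d dd"
    and \<alpha>: "0 \<le> \<alpha>" "\<alpha> \<le> pi / 2" "sin \<alpha> = 19 / 100 / sqrt n"
    and \<Delta>: "corrector_direction n H (arc_point \<alpha> v d dd) \<Delta>"
    and v': "v' = add_point (arc_point \<alpha> v d dd) \<Delta>"
    by (auto simp: arc_search_step_def)
  note pred = predictor_step[OF n H c v d dd \<alpha>]
  note corr = corrector_step[OF n H c pred(1) \<Delta>, folded v']
  show "v' \<in> N2 n H c (19 / 100)" by (rule corr)
  define \<mu> u where "\<mu> = gap n v" and "u = 1 / sqrt n"
  have mu: "0 < \<mu>" using pred(2) by (simp add: \<mu>_def)
  have u: "0 < u" "u \<le> 1" "1 / n = u\<^sup>2" using n by (auto simp: u_def power_divide)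
  have u2: "0 \<le> u\<^sup>2" "u\<^sup>2 \<le> u" using u by (auto simp: power2_eq_square mult_left_le_one_le)
  have "gap n (arc_point \<alpha> v d dd) \<le> (1 - 19 / 100 * u) * \<mu> + 27 / 2000 * \<mu> * u\<^sup>2"
  proof -
    have "27 / 2000 * gap n v / n = 27 / 2000 * \<mu> * u\<^sup>2" by (simp add: \<mu>_def flip: u(3))
    moreover have "sin \<alpha> = 19 / 100 * u" by (simp add: \<alpha>(3) u_def)
    ultimately show ?thesis using pred(3) unfolding \<mu>_def by (simp only: abs_le_iff) linarith
  qed
  also have "\<dots> = (1 - 19 / 100 * u + 27 / 2000 * u\<^sup>2) * \<mu>" by (simp add: algebra_simps)
  finally have mid: "gap n (arc_point \<alpha> v d dd) \<le> (1 - 19 / 100 * u + 27 / 2000 * u\<^sup>2) * \<mu>" .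
  have "gap n v' \<le> gap n (arc_point \<alpha> v d dd) * (1 + u\<^sup>2 / 40)"
  proof -
    have "1 / (40 * real n) = u\<^sup>2 / 40" by (simp flip: u(3))
    then show ?thesis using corr(2) by (simp only:)
  qed
  also have "\<dots> \<le> (1 - 19 / 100 * u + 27 / 2000 * u\<^sup>2) * \<mu> * (1 + u\<^sup>2 / 40)"
    using mid u2 by (intro mult_right_mono) auto
  also have "\<dots> = (1 - 19 / 100 * u + 27 / 2000 * u\<^sup>2) * (1 + u\<^sup>2 / 40) * \<mu>" by simp
  also have "\<dots> \<le> (1 - 3 / 20 * u) * \<mu>"
  proof (rule mult_right_mono)
    have "(1 - 19 / 100 * u + 27 / 2000 * u\<^sup>2) * (u\<^sup>2 / 40) \<le> 1 * (u\<^sup>2 / 40)"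
      using u u2 by (intro mult_right_mono) auto
    then show "(1 - 19 / 100 * u + 27 / 2000 * u\<^sup>2) * (1 + u\<^sup>2 / 40) \<le> 1 - 3 / 20 * u"
      unfolding distrib_left mult_1_right using u u2 by linarith
  qed (use mu in simp)
  finally show "gap n v' \<le> (1 - 3 / (20 * sqrt n)) * gap n v" by (simp add: u_def \<mu>_def)
qed

lemma arc_search_step_ex1:
  assumes n: "1 \<le> n" and H: "sym_pos_def n H" and c: "c \<in> carrier_vec n"
    and v: "v \<in> N2 n H c (19 / 100)"
  shows "\<exists>!v'. arc_search_step n H (19 / 100) v v'"
proof -
  have solvable: "\<exists>!d. direction_system n H w r s d"
    if "w \<in> N2 n H c \<theta>" "dim_vec r = n" "dim_vec s = n" for w r s \<theta>
    using that by (intro direction_system_ex1[OF H]) (auto simp: N2_def interior_feasible_def)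
  have carrD: "w \<in> qp_carrier n" if "w \<in> N2 n H c \<theta>" for w \<theta>
    using that by (auto simp: N2_def interior_feasible_def)
  have dims: "dim_vec (yc w) = n" "dim_vec (zc w) = n" "dim_vec (lamc w) = n"
    "dim_vec (gamc w) = n" if "w \<in> qp_carrier n" for w
    using that by (auto simp: qp_carrier_def)
  have "\<exists>!d. first_direction n H v d"
    unfolding first_direction_def
    by (rule solvable[OF v]) (simp_all add: dim_component_mult dims carrD[OF v])
  then obtain d where d: "first_direction n H v d" "\<And>d'. first_direction n H v d' \<Longrightarrow> d' = d"
    by blast
  have dc: "d \<in> qp_carrier n" using d(1) by (simp add: first_direction_def direction_system_def)
  have "\<exists>!dd. second_direction n H v d dd"
    unfolding second_direction_def
    by (rule solvable[OF v]) (simp_all add: dim_component_mult dims dc)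
  then obtain dd where dd: "second_direction n H v d dd"
    "\<And>d'. second_direction n H v d d' \<Longrightarrow> d' = dd" by blast
  define \<alpha> where "\<alpha> = arcsin (19 / 100 / sqrt n)"
  have "1 \<le> sqrt n" using n by simp
  then have "19 \<le> 100 * sqrt n" by linarith
  with n have le: "0 \<le> 19 / 100 / sqrt n" "19 / 100 / sqrt n \<le> 1"
    by (simp_all add: divide_le_eq)
  have \<alpha>: "0 \<le> \<alpha>" "\<alpha> \<le> pi / 2" "sin \<alpha> = 19 / 100 / sqrt n"
    unfolding \<alpha>_def using le arcsin_le_arcsin[of 0 "19 / 100 / sqrt n"]
    by (simp_all only: arcsin_0 arcsin_ubound sin_arcsin)
  have \<alpha>_unique: "\<alpha>' = \<alpha>" if "0 \<le> \<alpha>'" "\<alpha>' \<le> pi / 2" "sin \<alpha>' = 19 / 100 / sqrt n" for \<alpha>'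
    using that arcsin_sin[of \<alpha>'] by (simp add: \<alpha>_def)
  define a where "a = arc_point \<alpha> v d dd"
  have a: "a \<in> N2 n H c (27 / 100)"
    unfolding a_def by (rule predictor_step[OF n H c v d(1) dd(1) \<alpha>])
  have "\<exists>!\<Delta>. corrector_direction n H a \<Delta>"
    unfolding corrector_direction_def
    by (rule solvable[OF a]) (simp_all add: dim_component_mult dims carrD[OF a] ones_vec_def)
  then obtain \<Delta> where \<Delta>: "corrector_direction n H a \<Delta>"
    "\<And>d'. corrector_direction n H a d' \<Longrightarrow> d' = \<Delta>" by blast
  show ?thesis
  proof (rule ex1I)
    show "arc_search_step n H (19 / 100) v (add_point a \<Delta>)"
      unfolding arc_search_step_def using d(1) dd(1) \<alpha> \<Delta>(1) a_def by blast
    show "v' = add_point a \<Delta>" if "arc_search_step n H (19 / 100) v v'" for v'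
      using that d(2) dd(2) \<alpha>_unique \<Delta>(2) unfolding arc_search_step_def a_def by metis
  qed
qed

section \<open>The complexity bound\<close>

text \<open>
  Invariance of \<open>S\<close> carries the unique existence of a successor from the starting point to all iterates.
\<close>

lemma deterministic_iteration_ex1:
  assumes "x0 \<in> S" and ex1: "\<And>x. x \<in> S \<Longrightarrow> \<exists>!y. R x y"
    and closed: "\<And>x y. x \<in> S \<Longrightarrow> R x y \<Longrightarrow> y \<in> S"
  shows "\<exists>!f. f 0 = x0 \<and> (\<forall>k. R (f k) (f (Suc k)))"
proof -
  define f where "f = rec_nat x0 (\<lambda>_ x. THE y. R x y)"
  have f0: "f 0 = x0" and f_Suc: "f (Suc k) = (THE y. R (f k) y)" for k
    by (simp_all add: f_def)
  have f: "f k \<in> S \<and> R (f k) (f (Suc k))" for k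
  proof (induction k)
    case 0
    show ?case using theI'[OF ex1[OF \<open>x0 \<in> S\<close>]] \<open>x0 \<in> S\<close> by (simp add: f0 f_Suc)
  next
    case (Suc k)
    then have "f (Suc k) \<in> S" using closed by blast
    then show ?case using theI'[OF ex1, of "f (Suc k)"] by (simp add: f_Suc[of "Suc k"])
  qed
  show ?thesis
  proof (rule ex1I)
    show "f 0 = x0 \<and> (\<forall>k. R (f k) (f (Suc k)))" using f f0 by blast
    fix g assume g: "g 0 = x0 \<and> (\<forall>k. R (g k) (g (Suc k)))"
    have "g k = f k" for k
    proof (induction k)
      case (Suc k)
      then show ?case using ex1[of "f k"] f[of k] g by metis
    qed (use g f0 in simp)
    then show "g = f" by blast
  qed
qed

theorem theorem6p4:
  shows "\<exists>C::real. C > 0 \<and>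
    (\<forall>(n::nat) (H::real mat) (c::real vec) (\<epsilon>::real) (v0::qp_point).
      n \<ge> 1 \<longrightarrow> sym_pos_def n H \<longrightarrow> c \<in> carrier_vec n \<longrightarrow> 0 < \<epsilon> \<longrightarrow> \<epsilon> < 1 \<longrightarrow>
      v0 \<in> N2 n H c (19 / 100) \<longrightarrow> gap n v0 \<le> 1 / \<epsilon> \<longrightarrow>
      (\<exists>!v. arc_search_sequence n H (19 / 100) v0 v) \<and>
      (\<forall>v. arc_search_sequence n H (19 / 100) v0 v \<longrightarrow>
        (\<exists>K::nat. int K \<le> \<lceil>C * sqrt (real n) * ln (1 / \<epsilon>)\<rceil> \<and>
          (\<forall>k \<ge> K. gap n (v k) \<le> \<epsilon>))))"
\<comment> \<open>The gap must shrink by \<open>\<epsilon>\<^sup>2\<close>, so \<open>k * 3 / (20 sqrt n) \<ge> 2 ln (1 / \<epsilon>)\<close> is needed.\<close>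
proof (intro exI[of _ "40 / 3"] conjI allI impI)
  fix n :: nat and H :: "real mat" and c :: "real vec" and \<epsilon> :: real and v0 :: qp_point
  assume n: "1 \<le> n" and H: "sym_pos_def n H" and c: "c \<in> carrier_vec n"
    and eps: "0 < \<epsilon>" "\<epsilon> < 1" and v0: "v0 \<in> N2 n H c (19 / 100)" "gap n v0 \<le> 1 / \<epsilon>"
  note contracts = arc_search_step_contracts[OF n H c]
  show "\<exists>!v. arc_search_sequence n H (19 / 100) v0 v"
    unfolding arc_search_sequence_def
    by (rule deterministic_iteration_ex1[OF v0(1) arc_search_step_ex1[OF n H c] contracts(1)])
  fix v assume "arc_search_sequence n H (19 / 100) v0 v"
  then have v: "v 0 = v0" "\<And>k. arc_search_step n H (19 / 100) (v k) (v (Suc k))"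
    by (auto simp: arc_search_sequence_def)
  define \<rho> where "\<rho> = 1 - 3 / (20 * sqrt n)"
  have "1 \<le> sqrt n" using n by simp
  then have "3 \<le> 20 * sqrt n" by linarith
  with n have rho: "0 \<le> \<rho>" by (simp add: \<rho>_def divide_le_eq)
  have bound: "v k \<in> N2 n H c (19 / 100) \<and> gap n (v k) \<le> \<rho> ^ k / \<epsilon>" for k
  proof (induction k)
    case (Suc k)
    have "gap n (v (Suc k)) \<le> \<rho> * gap n (v k)"
      unfolding \<rho>_def using Suc v(2) by (intro contracts(2)) auto
    also have "\<dots> \<le> \<rho> * (\<rho> ^ k / \<epsilon>)" using Suc rho by (intro mult_left_mono) auto
    finally show ?case using Suc contracts(1)[OF _ v(2)] by simp
  qed (use v v0 in simp)
  define K where "K = nat \<lceil>40 / 3 * sqrt n * ln (1 / \<epsilon>)\<rceil>"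
  have ln_pos: "0 \<le> ln (1 / \<epsilon>)" using eps by simp
  have "gap n (v k) \<le> \<epsilon>" if k: "K \<le> k" for k
  proof -
    have "40 / 3 * sqrt n * ln (1 / \<epsilon>) \<le> real k" using k by (simp add: K_def ceiling_le_iff nat_le_iff)
    then have *: "2 * ln (1 / \<epsilon>) \<le> 3 / (20 * sqrt n) * real k" using n by (simp add: field_simps)
    have "gap n (v k) \<le> \<rho> ^ k / \<epsilon>" using bound by blast
    also have "\<rho> ^ k \<le> exp (- (3 / (20 * sqrt n))) ^ k"
      using rho exp_ge_add_one_self[of "- (3 / (20 * sqrt n))"] by (intro power_mono) (auto simp: \<rho>_def)
    also have "\<dots> = exp (- (3 / (20 * sqrt n) * real k))"
      by (simp flip: exp_of_nat_mult)
    also have "\<dots> \<le> exp (- (2 * ln (1 / \<epsilon>)))" using * by simp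
    also have "\<dots> = \<epsilon>\<^sup>2" using eps by (simp add: ln_div exp_double)
    finally show ?thesis using eps by (simp add: divide_right_mono power2_eq_square)
  qed
  moreover have "int K \<le> \<lceil>40 / 3 * sqrt n * ln (1 / \<epsilon>)\<rceil>"
  proof -
    have "0 \<le> 40 / 3 * sqrt n * ln (1 / \<epsilon>)" using ln_pos by (intro mult_nonneg_nonneg) auto
    then have "0 \<le> \<lceil>40 / 3 * sqrt n * ln (1 / \<epsilon>)\<rceil>" by linarith
    then show ?thesis unfolding K_def by simp
  qed
  ultimately show "\<exists>K::nat. int K \<le> \<lceil>40 / 3 * sqrt (real n) * ln (1 / \<epsilon>)\<rceil> \<and>
      (\<forall>k \<ge> K. gap n (v k) \<le> \<epsilon>)" by blast
qed simp

end
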